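(* Let $W$ be a non-negative, integer-valued random variable with $\mathbb{E}[W]=\lambda>0$ satisfying $W+1\geq_{st}W^\star$, where $W^\star$ has the $W$-size-biased distribution. Then $$\frac{\partial}{\partial\alpha}H(W_\alpha)\leq0\qquad\text{and}\qquad\frac{\partial^2}{\partial\alpha^2}H(W_\alpha)\leq0,$$ with equality if and only if $W$ has a Poisson distribution.
   Context: $\mathrm{Po}(\mu)$ is the Poisson distribution with mean $\mu$. $W^\star$ has mass function $\mathbb{P}(W^\star=j)=j\,\mathbb{P}(W=j)/\lambda$, $j\in\{0,1,2,\ldots\}$. $\geq_{st}$ denotes the usual stochastic order. The entropy of a non-negative integer-valued random variable $X$ is $H(X)=-\sum_{i=0}^\infty\mathbb{P}(X=i)\log\mathbb{P}(X=i)$ (natural logarithm). Definition of $W_\alpha$: for $\alpha\in[0,1]$, $W_\alpha$ is a random variable equal in distribution to $T_\alpha W+Z_{(1-\alpha)\lambda}$, where $T_\alpha W=\sum_{i=1}^W\eta_i$ with $\eta_1,\eta_2,\ldots$ iid Bernoulli random variables of mean $\alpha$, independent of $W$, and $Z_{(1-\alpha)\lambda}\sim\mathrm{Po}((1-\alpha)\lambda)$ independent of all else. *)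

theory Defs
  imports "HOL-Probability.Probability"
begin

text \<open>
  All notions involved depend on the random variables only through their distributions,
  so a non-negative integer-valued random variable is represented by its law, a
  \<^typ>\<open>nat pmf\<close>.
\<close>

definition entropy_pmf :: "nat pmf \<Rightarrow> real" where
  "entropy_pmf p = - (\<Sum>i. pmf p i * ln (pmf p i))"

text \<open>The library's \<^const>\<open>poisson_pmf\<close> is only meaningful for a positive rate.\<close>

definition poisson_law :: "real \<Rightarrow> nat pmf" where
  "poisson_law \<mu> = (if \<mu> > 0 then poisson_pmf \<mu> else return_pmf 0)"

definition is_poisson :: "nat pmf \<Rightarrow> bool" where
  "is_poisson W \<longleftrightarrow> (\<exists>\<mu>\<ge>0. W = poisson_law \<mu>)"

abbreviation mean :: "nat pmf \<Rightarrow> real" where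
  "mean W \<equiv> measure_pmf.expectation W real"

text \<open>Only meaningful if \<open>W\<close> has a finite and positive mean; see \<open>pmf_size_biased\<close> below.\<close>

definition size_biased :: "nat pmf \<Rightarrow> nat pmf" where
  "size_biased W = embed_pmf (\<lambda>j. real j * pmf W j / mean W)"

definition st_ge :: "nat pmf \<Rightarrow> nat pmf \<Rightarrow> bool" (infix \<open>\<ge>\<^sub>s\<^sub>t\<close> 50) where
  "X \<ge>\<^sub>s\<^sub>t Y \<longleftrightarrow> (\<forall>t. measure_pmf.prob X {t<..} \<ge> measure_pmf.prob Y {t<..})"

text \<open>
  Given \<open>W = w\<close>, the variables \<open>\<eta> 1, \<dots>, \<eta> w\<close> are independent Bernoulli variables of
  mean \<open>\<alpha>\<close> with values in \<open>{0, 1}\<close>; the second argument of \<^const>\<open>Pi_pmf\<close> is the irrelevant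
  value of \<open>\<eta>\<close> outside \<open>{1..w}\<close>.
\<close>

definition thinning :: "real \<Rightarrow> nat pmf \<Rightarrow> nat pmf" where
  "thinning \<alpha> W = do {
     w \<leftarrow> W;
     \<eta> \<leftarrow> Pi_pmf {1..w} 0 (\<lambda>_. map_pmf of_bool (bernoulli_pmf \<alpha>));
     return_pmf (\<Sum>i=1..w. \<eta> i)
   }"

text \<open>The law of \<open>W\<^sub>\<alpha>\<close>, for \<open>0 \<le> \<alpha> \<le> 1\<close>.\<close>

definition thinned_interp :: "nat pmf \<Rightarrow> real \<Rightarrow> nat pmf" where
  "thinned_interp W \<alpha> = do {
     t \<leftarrow> thinning \<alpha> W;
     z \<leftarrow> poisson_law ((1 - \<alpha>) * mean W);
     return_pmf (t + z)
   }"

text \<open>Sanity checks for the definitions.\<close>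

lemma pmf_size_biased:
  assumes "integrable (measure_pmf W) real" and "mean W > 0"
  shows "pmf (size_biased W) j = real j * pmf W j / mean W"
  unfolding size_biased_def
proof (rule pmf_embed_pmf)
  show "0 \<le> real j * pmf W j / mean W" for j
    using assms by simp
  have "(\<integral>\<^sup>+ j. ennreal (real j * pmf W j / mean W) \<partial>count_space UNIV)
      = (\<integral>\<^sup>+ j. ennreal (pmf W j) * ennreal (real j / mean W) \<partial>count_space UNIV)"
    using assms by (intro nn_integral_cong) (simp add: ennreal_mult[symmetric] mult_ac)
  also have "\<dots> = (\<integral>\<^sup>+ j. ennreal (real j / mean W) \<partial>measure_pmf W)"
    by (simp add: nn_integral_measure_pmf)
  also have "\<dots> = ennreal (\<integral>j. real j / mean W \<partial>measure_pmf W)"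
    using assms by (intro nn_integral_eq_integral integrable_divide AE_pmfI) auto
  also have "\<dots> = 1"
    using assms by simp
  finally show "(\<integral>\<^sup>+ j. ennreal (real j * pmf W j / mean W) \<partial>count_space UNIV) = 1" .
qed

lemma thinning_binomial:
  assumes "0 \<le> \<alpha>" "\<alpha> \<le> 1"
  shows "thinning \<alpha> W = bind_pmf W (\<lambda>w. binomial_pmf w \<alpha>)"
proof -
  have "bind_pmf (Pi_pmf {1..w} 0 (\<lambda>_. map_pmf of_bool (bernoulli_pmf \<alpha>)))
          (\<lambda>\<eta>. return_pmf (\<Sum>i=1..w. \<eta> i)) = binomial_pmf w \<alpha>" for w :: nat
  proof -
    have "Pi_pmf {1..w} (0::nat) (\<lambda>_. map_pmf of_bool (bernoulli_pmf \<alpha>))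
        = map_pmf (\<lambda>g. of_bool \<circ> g) (Pi_pmf {1..w} False (\<lambda>_. bernoulli_pmf \<alpha>) :: (nat \<Rightarrow> bool) pmf)"
      by (rule Pi_pmf_map) auto
    then have "bind_pmf (Pi_pmf {1..w} (0::nat) (\<lambda>_. map_pmf of_bool (bernoulli_pmf \<alpha>)))
          (\<lambda>\<eta>. return_pmf (\<Sum>i=1..w. \<eta> i))
        = map_pmf (\<lambda>g. \<Sum>i=1..w. of_bool (g i)) (Pi_pmf {1..w} False (\<lambda>_. bernoulli_pmf \<alpha>))"
      by (simp only: map_pmf_def[symmetric] map_pmf_comp comp_def)
    also have "\<dots> = map_pmf (\<lambda>g. card {i\<in>{1..w}. g i}) (Pi_pmf {1..w} False (\<lambda>_. bernoulli_pmf \<alpha>))"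
      by (simp add: of_bool_def sum.If_cases Int_def)
    also have "\<dots> = binomial_pmf w \<alpha>"
      using assms by (intro binomial_pmf_altdef'[symmetric]) auto
    finally show ?thesis .
  qed
  then show ?thesis
    unfolding thinning_def by simp
qed

text \<open>
  The series defining the entropy converges for every law with finite mean, in particular
  for all laws \<open>W\<^sub>\<alpha>\<close>.
\<close>

lemma entropy_summable:
  assumes "integrable (measure_pmf p) real"
  shows "summable (\<lambda>i. pmf p i * ln (pmf p i))"
proof (rule summable_comparison_test')
  have "integrable (count_space UNIV) (\<lambda>i. pmf p i * real i)"
    using assms unfolding measure_pmf_eq_density
    by (subst (asm) integrable_density) auto
  then have "summable (\<lambda>i. real i * pmf p i)"
    by (simp add: integrable_count_space_nat_iff abs_mult mult_ac)
  moreover have "summable (\<lambda>i. 2 * exp (- 1 / 2 :: real) ^ i)"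
    by (intro summable_mult summable_geometric) simp
  ultimately show "summable (\<lambda>i. real i * pmf p i + 2 * exp (- 1 / 2) ^ i)"
    by (rule summable_add)
  show "norm (pmf p i * ln (pmf p i)) \<le> real i * pmf p i + 2 * exp (- 1 / 2) ^ i"
    if "i \<ge> 0" for i
  proof (cases "pmf p i = 0")
    case False
    define q where "q = pmf p i"
    have q: "0 < q" "q \<le> 1"
      using False by (auto simp: q_def pmf_le_1 pmf_pos)
    have norm_eq: "norm (q * ln q) = q * (- ln q)"
      using q by (simp add: abs_mult)
    show ?thesis
    proof (cases "exp (- real i) \<le> q")
      case True
      then have "- ln q \<le> real i"
        using q by (metis exp_le_cancel_iff exp_ln minus_le_iff)
      then have "q * (- ln q) \<le> q * real i"
        using q by (intro mult_left_mono) auto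
      moreover have "0 \<le> 2 * exp (- 1 / 2 :: real) ^ i"
        by simp
      ultimately show ?thesis
        unfolding q_def[symmetric] norm_eq mult.commute[of "real i" q] by linarith
    next
      case False
      have "- ln q = 2 * ln (1 / sqrt q)"
        using q by (simp add: ln_div ln_sqrt)
      also have "\<dots> \<le> 2 * (1 / sqrt q)"
        using q ln_le_minus_one[of "1 / sqrt q"] by simp
      finally have "q * (- ln q) \<le> q * (2 * (1 / sqrt q))"
        using q by (intro mult_left_mono) auto
      also have "\<dots> = 2 * sqrt q"
        using q by (simp add: field_simps)
      also have "sqrt q \<le> sqrt (exp (- real i))"
        using False by simp
      also have "sqrt (exp (- real i)) = exp (- 1 / 2) ^ i"
        by (simp add: exp_of_nat_mult[symmetric] real_sqrt_unique power2_eq_square exp_add[symmetric])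
      finally show ?thesis
        using q unfolding q_def[symmetric] norm_eq by (simp add: add_increasing)
    qed
  qed simp
qed

lemma integrable_poisson_law: "integrable (measure_pmf (poisson_law \<mu>)) real"
proof (cases "\<mu> > 0")
  case True
  have "summable (\<lambda>k. \<mu> ^ k / fact k * exp (- \<mu>) * real k)"
  proof (subst summable_Suc_iff[symmetric])
    have "\<mu> ^ Suc k / fact (Suc k) * exp (- \<mu>) * real (Suc k) = \<mu> * exp (- \<mu>) * (\<mu> ^ k /\<^sub>R fact k)"
      for k by (simp add: field_simps del: of_nat_Suc)
    then show "summable (\<lambda>k. \<mu> ^ Suc k / fact (Suc k) * exp (- \<mu>) * real (Suc k))"
      using summable_exp_generic[of \<mu>] by (simp only: summable_mult)
  qed
  then have "integrable (measure_pmf (poisson_pmf \<mu>)) real"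
    using True unfolding measure_pmf_eq_density
    by (subst integrable_density) (auto simp: integrable_count_space_nat_iff abs_mult)
  then show ?thesis
    using True by (simp add: poisson_law_def)
qed (simp add: poisson_law_def integrable_measure_pmf_finite)

lemma integrable_thinned_interp:
  assumes "integrable (measure_pmf W) real" "0 \<le> \<alpha>" "\<alpha> \<le> 1"
  shows "integrable (measure_pmf (thinned_interp W \<alpha>)) real"
proof (rule integrableI_bounded)
  define P where "P = poisson_law ((1 - \<alpha>) * mean W)"
  define C where "C = (\<integral>\<^sup>+ z. ennreal (real z) \<partial>measure_pmf P)"
  have C: "C < \<infinity>"
    using integrable_poisson_law[of "(1 - \<alpha>) * mean W"]
    by (simp add: C_def P_def integrable_iff_bounded)
  have EW: "(\<integral>\<^sup>+ w. ennreal (real w) \<partial>measure_pmf W) < \<infinity>"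
    using assms(1) by (simp add: integrable_iff_bounded)
  have "(\<integral>\<^sup>+ x. ennreal (norm (real x)) \<partial>measure_pmf (thinned_interp W \<alpha>))
      = (\<integral>\<^sup>+ w. \<integral>\<^sup>+ t. \<integral>\<^sup>+ z. ennreal (real t) + ennreal (real z) \<partial>measure_pmf P
            \<partial>measure_pmf (binomial_pmf w \<alpha>) \<partial>measure_pmf W)"
    using assms(2,3) by (simp add: thinned_interp_def thinning_binomial P_def)
  also have "\<dots> = (\<integral>\<^sup>+ w. \<integral>\<^sup>+ t. ennreal (real t) + C \<partial>measure_pmf (binomial_pmf w \<alpha>) \<partial>measure_pmf W)"
    by (simp add: nn_integral_add C_def)
  also have "\<dots> \<le> (\<integral>\<^sup>+ w. \<integral>\<^sup>+ t. ennreal (real w) + C \<partial>measure_pmf (binomial_pmf w \<alpha>) \<partial>measure_pmf W)"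
  proof (intro nn_integral_mono_AE AE_pmfI)
    fix w t assume "w \<in> set_pmf W" and "t \<in> set_pmf (binomial_pmf w \<alpha>)"
    then have "t \<le> w"
      using assms(2,3) by (auto simp: set_pmf_binomial_eq split: if_splits)
    then show "ennreal (real t) + C \<le> ennreal (real w) + C"
      by (intro add_right_mono ennreal_leI) simp
  qed
  also have "\<dots> = (\<integral>\<^sup>+ w. ennreal (real w) \<partial>measure_pmf W) + C"
    by (simp add: nn_integral_add)
  also have "\<dots> < \<infinity>"
    using C EW by simp
  finally show "(\<integral>\<^sup>+ x. ennreal (norm (real x)) \<partial>measure_pmf (thinned_interp W \<alpha>)) < \<infinity>" .
qed simp

end

theory Submission
  imports Defs
begin

text \<open>
  Write \<open>l\<close> for the mean of \<open>W\<close>, \<open>P\<close> for its mass function, \<open>p a\<close> for the mass function of the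
  interpolating law at parameter \<open>a\<close>, and \<open>bdiff f j = f j - f (j - 1)\<close> with \<open>f (-1) = 0\<close>. Thinning with parameter
  \<open>a\<close> followed by adding Poisson noise of mean \<open>(1 - a) l\<close> is a linear operation on sequences, called
  \<open>flow l a\<close> below. On generating functions it sends \<open>M(s)\<close> to \<open>M(1 + a(s - 1)) exp((1 - a) l (s - 1))\<close>,
  and three rules follow: differences are scaled by \<open>a\<close> (\<open>flow_bdiff\<close>), and with
  \<open>drift l \<mu> j = (j + 1) \<mu> (j + 1) - l \<mu> j\<close> the operation turns \<open>drift l \<mu>\<close> into \<open>1 / a\<close> times the drift
  of the image (\<open>flow_drift\<close>) and has \<open>a\<close>-derivative \<open>- bdiff (flow l a (drift l \<mu>))\<close> (\<open>flow_deriv\<close>).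
  Hence \<open>p' = - bdiff r\<close> and \<open>p'' = bdiff (bdiff t)\<close>, where \<open>r = flow l a (drift l P)\<close>
  and \<open>t = flow l a (drift l (drift l P))\<close>.

  The stochastic order between \<open>W + 1\<close> and the size-biased law says exactly that
  \<open>drift l P = bdiff R\<close> for some \<open>R \<ge> 0\<close>. Therefore \<open>r = a \<cdot> bdiff V\<close> with \<open>V = flow l a R \<ge> 0\<close>, and
  summation by parts shows \<open>\<Sum> r \<phi> \<le> 0\<close> for every strictly increasing \<open>\<phi>\<close>, with equality only if
  \<open>R = 0\<close>, that is, only if \<open>(j + 1) P (j + 1) = l P j\<close> for all \<open>j\<close> and \<open>W\<close> is Poisson
  (\<open>drift_against_increasing\<close>).

  The entropy is minus the relative entropy with respect to the Poisson law of mean \<open>l\<close>, plus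
  the expectation of \<open>ln (j!)\<close>, plus a constant. Summation by parts turns the first derivative into
  \<open>\<Sum> r\<^sub>j ln ((j + 1) / l)\<close>, which is controlled by the preceding paragraph, minus
  \<open>\<Sum> r\<^sub>j ln ((j + 1) p\<^sub>j\<^sub>+\<^sub>1 / (l p\<^sub>j))\<close>, whose terms are nonnegative because
  \<open>a r\<^sub>j = (j + 1) p\<^sub>j\<^sub>+\<^sub>1 - l p\<^sub>j\<close> (\<open>entropy_deriv_sign\<close>). In the second derivative the
  contribution of \<open>ln (j!)\<close> is again a sum of \<open>r\<close> against a strictly increasing sequence. The
  relative entropy is convex in \<open>a\<close>: after shifting some of the terms of \<open>\<Sum> p'\<^sup>2 / p\<close> by one index, its second
  derivative becomes a sum of terms which are nonnegative by \<open>ln_ratio_ineq\<close>, an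
  elementary inequality between three positive numbers (\<open>entropy_deriv2_sign\<close>).

  Differentiation under the sums is justified by tail bounds. The stochastic order forces
  \<open>P(W \<ge> t) \<le> l^t / t!\<close> (\<open>tail_le\<close>), so all the sequences that occur are bounded by
  \<open>C K^j / j!\<close>, uniformly in \<open>a\<close>. Since \<open>p\<close> is also bounded below by an expression of this
  form, locally uniformly in \<open>a < 1\<close>, logarithms of \<open>p\<close> and quotients by \<open>p\<close> grow at most geometrically, and
  all products are dominated by summable sequences.
\<close>

section \<open>Geometric growth and factorial decay, uniformly over a family\<close>

definition rshift :: "(nat \<Rightarrow> real) \<Rightarrow> nat \<Rightarrow> real" where
  "rshift f n = (if n = 0 then 0 else f (n - 1))"

definition bdiff :: "(nat \<Rightarrow> real) \<Rightarrow> nat \<Rightarrow> real" where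
  "bdiff f n = f n - rshift f n"

lemma rshift_0 [simp]: "rshift f 0 = 0" and rshift_Suc [simp]: "rshift f (Suc n) = f n"
  by (simp_all add: rshift_def)

text \<open>
  A single constant \<open>K\<close> covers both the factor and the rate, since \<open>C L^n \<le> K^(n+1)\<close> for
  \<open>K = max {1, C, L}\<close>; this keeps the closure properties free of case distinctions. The index \<open>i\<close> is the
  parameter over which all bounds are uniform.
\<close>

definition exp_bounded :: "'i set \<Rightarrow> ('i \<Rightarrow> nat \<Rightarrow> real) \<Rightarrow> bool" where
  "exp_bounded I y \<longleftrightarrow> (\<exists>K. \<forall>i\<in>I. \<forall>n. \<bar>y i n\<bar> \<le> K ^ Suc n)"

definition fact_small :: "'i set \<Rightarrow> ('i \<Rightarrow> nat \<Rightarrow> real) \<Rightarrow> bool" where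
  "fact_small I x \<longleftrightarrow> exp_bounded I (\<lambda>i n. fact n * x i n)"

lemma exp_boundedI: "(\<And>i n. i \<in> I \<Longrightarrow> \<bar>y i n\<bar> \<le> K ^ Suc n) \<Longrightarrow> exp_bounded I y"
  unfolding exp_bounded_def by blast

lemma exp_boundedE:
  assumes "exp_bounded I y"
  obtains K where "K \<ge> 1" "\<And>i n. i \<in> I \<Longrightarrow> \<bar>y i n\<bar> \<le> K ^ Suc n"
proof -
  obtain K where K: "\<And>i n. i \<in> I \<Longrightarrow> \<bar>y i n\<bar> \<le> K ^ Suc n"
    using assms unfolding exp_bounded_def by blast
  have "\<bar>y i n\<bar> \<le> (max 1 \<bar>K\<bar>) ^ Suc n" if "i \<in> I" for i n
  proof -
    have "K ^ Suc n \<le> \<bar>K\<bar> ^ Suc n"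
      by (metis abs_ge_self power_abs)
    also have "\<dots> \<le> (max 1 \<bar>K\<bar>) ^ Suc n"
      by (intro power_mono) auto
    finally show ?thesis
      using K[OF that, of n] by linarith
  qed
  then show ?thesis
    using that[of "max 1 \<bar>K\<bar>"] by auto
qed

lemma exp_bounded_mono:
  assumes "exp_bounded I y" "\<And>i n. i \<in> J \<Longrightarrow> i \<in> I \<and> \<bar>x i n\<bar> \<le> \<bar>y i n\<bar>"
  shows "exp_bounded J x"
  using assms unfolding exp_bounded_def by (meson order_trans)

lemma exp_bounded_const: "exp_bounded I (\<lambda>_ _. c)"
proof (rule exp_boundedI)
  fix n :: nat
  have "max 1 \<bar>c\<bar> ^ 1 \<le> max 1 \<bar>c\<bar> ^ Suc n"
    by (rule power_increasing) auto
  then show "\<bar>c\<bar> \<le> max 1 \<bar>c\<bar> ^ Suc n"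
    by simp
qed

lemma exp_bounded_nat: "exp_bounded I (\<lambda>_ n. real n)"
proof (rule exp_boundedI)
  fix n :: nat
  have "real n \<le> 2 ^ n"
    by (metis less_exp less_imp_le of_nat_less_numeral_power_cancel_iff of_nat_le_iff of_nat_numeral of_nat_power)
  also have "\<dots> \<le> 2 ^ Suc n"
    by simp
  finally show "\<bar>real n\<bar> \<le> 2 ^ Suc n"
    by simp
qed

lemma exp_bounded_add:
  assumes "exp_bounded I x" "exp_bounded I y"
  shows "exp_bounded I (\<lambda>i n. x i n + y i n)"
proof -
  obtain K where K: "K \<ge> 1" "\<And>i n. i \<in> I \<Longrightarrow> \<bar>x i n\<bar> \<le> K ^ Suc n"
    using exp_boundedE[OF assms(1)] by metis
  obtain L where L: "L \<ge> 1" "\<And>i n. i \<in> I \<Longrightarrow> \<bar>y i n\<bar> \<le> L ^ Suc n"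
    using exp_boundedE[OF assms(2)] by metis
  show ?thesis
  proof (rule exp_boundedI)
    fix i n assume "i \<in> I"
    have "\<bar>x i n + y i n\<bar> \<le> K ^ Suc n + L ^ Suc n"
      using K(2)[OF \<open>i \<in> I\<close>, of n] L(2)[OF \<open>i \<in> I\<close>, of n] by linarith
    also have "\<dots> \<le> K * (K + L) ^ n + L * (K + L) ^ n"
      using K(1) L(1) by (auto intro!: add_mono mult_left_mono power_mono)
    finally show "\<bar>x i n + y i n\<bar> \<le> (K + L) ^ Suc n"
      by (simp add: algebra_simps)
  qed
qed

lemma exp_bounded_mult:
  assumes "exp_bounded I x" "exp_bounded I y"
  shows "exp_bounded I (\<lambda>i n. x i n * y i n)"
proof -
  obtain K where K: "K \<ge> 1" "\<And>i n. i \<in> I \<Longrightarrow> \<bar>x i n\<bar> \<le> K ^ Suc n"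
    using exp_boundedE[OF assms(1)] by metis
  obtain L where L: "L \<ge> 1" "\<And>i n. i \<in> I \<Longrightarrow> \<bar>y i n\<bar> \<le> L ^ Suc n"
    using exp_boundedE[OF assms(2)] by metis
  show ?thesis
  proof (rule exp_boundedI)
    fix i n assume "i \<in> I"
    show "\<bar>x i n * y i n\<bar> \<le> (K * L) ^ Suc n"
      unfolding abs_mult power_mult_distrib
      using K(1) by (intro mult_mono K L \<open>i \<in> I\<close>) auto
  qed
qed

lemma exp_bounded_minus: "exp_bounded I x \<Longrightarrow> exp_bounded I (\<lambda>i n. - x i n)"
  by (simp add: exp_bounded_def)

lemma exp_bounded_diff:
  "exp_bounded I x \<Longrightarrow> exp_bounded I y \<Longrightarrow> exp_bounded I (\<lambda>i n. x i n - y i n)"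
  using exp_bounded_add[of I x "\<lambda>i n. - y i n"] by (simp add: exp_bounded_minus)

lemma exp_bounded_Suc:
  assumes "exp_bounded I x"
  shows "exp_bounded I (\<lambda>i n. x i (Suc n))"
proof -
  obtain K where K: "K \<ge> 1" "\<And>i n. i \<in> I \<Longrightarrow> \<bar>x i n\<bar> \<le> K ^ Suc n"
    using exp_boundedE[OF assms] by metis
  show ?thesis
  proof (rule exp_boundedI)
    fix i n assume "i \<in> I"
    have "\<bar>x i (Suc n)\<bar> \<le> K ^ (Suc (Suc n))"
      by (rule K) fact
    also have "\<dots> \<le> K ^ (2 * Suc n)"
      using K(1) by (intro power_increasing) auto
    finally show "\<bar>x i (Suc n)\<bar> \<le> (K ^ 2) ^ Suc n"
      by (simp only: power_mult)
  qed
qed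

lemma exp_bounded_pred:
  assumes "exp_bounded I x"
  shows "exp_bounded I (\<lambda>i n. x i (n - 1))"
proof -
  obtain K where K: "K \<ge> 1" "\<And>i n. i \<in> I \<Longrightarrow> \<bar>x i n\<bar> \<le> K ^ Suc n"
    using exp_boundedE[OF assms] by metis
  show ?thesis
  proof (rule exp_boundedI)
    fix i n assume "i \<in> I"
    have "\<bar>x i (n - 1)\<bar> \<le> K ^ (Suc (n - 1))"
      by (rule K) fact
    also have "\<dots> \<le> K ^ Suc n"
      using K(1) by (intro power_increasing) auto
    finally show "\<bar>x i (n - 1)\<bar> \<le> K ^ Suc n" .
  qed
qed

lemma fact_small_mono:
  assumes "fact_small I y" "\<And>i n. i \<in> J \<Longrightarrow> i \<in> I \<and> \<bar>x i n\<bar> \<le> \<bar>y i n\<bar>"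
  shows "fact_small J x"
  using assms(1) unfolding fact_small_def
  by (rule exp_bounded_mono) (use assms(2) in \<open>auto simp: abs_mult intro!: mult_left_mono\<close>)

lemma fact_small_add:
  "fact_small I x \<Longrightarrow> fact_small I y \<Longrightarrow> fact_small I (\<lambda>i n. x i n + y i n)"
  unfolding fact_small_def by (simp add: distrib_left exp_bounded_add)

lemma fact_small_minus: "fact_small I x \<Longrightarrow> fact_small I (\<lambda>i n. - x i n)"
  unfolding fact_small_def by (simp add: exp_bounded_minus)

lemma fact_small_diff:
  "fact_small I x \<Longrightarrow> fact_small I y \<Longrightarrow> fact_small I (\<lambda>i n. x i n - y i n)"
  unfolding fact_small_def by (simp add: right_diff_distrib exp_bounded_diff)

lemma fact_small_mult:
  "fact_small I x \<Longrightarrow> exp_bounded I y \<Longrightarrow> fact_small I (\<lambda>i n. x i n * y i n)"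
  unfolding fact_small_def by (simp flip: mult.assoc add: exp_bounded_mult)

lemma fact_small_mult':
  "exp_bounded I y \<Longrightarrow> fact_small I x \<Longrightarrow> fact_small I (\<lambda>i n. y i n * x i n)"
  using fact_small_mult[of I x y] by (simp add: mult.commute)

lemma fact_small_Suc:
  assumes "fact_small I x"
  shows "fact_small I (\<lambda>i n. x i (Suc n))"
  unfolding fact_small_def
proof (rule exp_bounded_mono)
  show "exp_bounded I (\<lambda>i n. fact (Suc n) * x i (Suc n))"
    using assms unfolding fact_small_def by (rule exp_bounded_Suc)
  show "i \<in> I \<and> \<bar>fact n * x i (Suc n)\<bar> \<le> \<bar>fact (Suc n) * x i (Suc n)\<bar>" if "i \<in> I" for i n
    using that fact_mono[of n "Suc n", where 'a=real]
    by (auto simp: abs_mult simp del: fact_Suc intro!: mult_right_mono)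
qed

lemma fact_small_rshift:
  assumes "fact_small I x"
  shows "fact_small I (\<lambda>i. rshift (x i))"
  unfolding fact_small_def
proof (rule exp_bounded_mono)
  show "exp_bounded I (\<lambda>i n. real n * (fact (n - 1) * x i (n - 1)))"
    using assms unfolding fact_small_def
    by (rule exp_bounded_mult[OF exp_bounded_nat exp_bounded_pred])
  show "i \<in> I \<and> \<bar>fact n * rshift (x i) n\<bar>
      \<le> \<bar>real n * (fact (n - 1) * x i (n - 1))\<bar>" if "i \<in> I" for i n
    using that by (cases n) (auto simp: algebra_simps)
qed

lemma fact_small_bdiff: "fact_small I x \<Longrightarrow> fact_small I (\<lambda>i. bdiff (x i))"
  unfolding bdiff_def by (intro fact_small_diff fact_small_rshift)

text \<open>
  A lower bound of factorial type on the denominator makes the two factorials cancel. It is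
  the reason why \<open>p'\<^sup>2 / p\<close> remains summable.
\<close>

lemma exp_bounded_div:
  assumes "fact_small I x" "K > 0" "\<And>i n. i \<in> I \<Longrightarrow> K ^ Suc n / fact n \<le> p i n"
  shows "exp_bounded I (\<lambda>i n. x i n / p i n)"
proof (rule exp_bounded_mono)
  \<comment> \<open>Dividing by \<open>K^(n+1) / n!\<close> multiplies by \<open>n!\<close>, which the decay of \<open>x\<close> absorbs.\<close>
  have "exp_bounded I (\<lambda>_ n. (1 / K) ^ Suc n)"
    by (rule exp_boundedI[where K = "1 / K"]) (use \<open>K > 0\<close> in simp)
  then show "exp_bounded I (\<lambda>i n. (fact n * x i n) * (1 / K) ^ Suc n)"
    using assms(1) unfolding fact_small_def by (rule exp_bounded_mult[rotated])
  show "i \<in> I \<and> \<bar>x i n / p i n\<bar> \<le> \<bar>(fact n * x i n) * (1 / K) ^ Suc n\<bar>" if "i \<in> I" for i n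
  proof -
    have pos: "0 < K ^ Suc n / fact n"
      using \<open>K > 0\<close> by simp
    have p: "0 < p i n"
      using less_le_trans[OF pos assms(3)[OF that]] .
    have "\<bar>x i n / p i n\<bar> = \<bar>x i n\<bar> / p i n"
      using p by simp
    also have "\<dots> \<le> \<bar>x i n\<bar> / (K ^ Suc n / fact n)"
      using assms(3)[OF that, of n] pos by (intro divide_left_mono mult_pos_pos p) auto
    also have "\<dots> = \<bar>(fact n * x i n) * (1 / K) ^ Suc n\<bar>"
      using \<open>K > 0\<close> by (simp add: abs_mult field_simps)
    finally show ?thesis
      using that by simp
  qed
qed

text \<open>
  The logarithm of \<open>K^(n+1) / n!\<close> is of order \<open>n ln n\<close>; the crude bound \<open>n\<^sup>2\<close> suffices.
\<close>

lemma exp_bounded_ln: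
  assumes "K > 0" "\<And>i n. i \<in> I \<Longrightarrow> K ^ Suc n / fact n \<le> p i n" "\<And>i n. i \<in> I \<Longrightarrow> p i n \<le> 1"
  shows "exp_bounded I (\<lambda>i n. ln (p i n))"
proof (rule exp_bounded_mono)
  show "exp_bounded I (\<lambda>i n. real n * real n + (real n + 1) * \<bar>ln K\<bar>)"
    by (intro exp_bounded_add exp_bounded_mult exp_bounded_nat exp_bounded_const)
  show "i \<in> I \<and> \<bar>ln (p i n)\<bar> \<le> \<bar>real n * real n + (real n + 1) * \<bar>ln K\<bar>\<bar>" if "i \<in> I" for i n
  proof -
    have pos: "0 < K ^ Suc n / fact n"
      using \<open>K > 0\<close> by simp
    have p: "0 < p i n"
      using less_le_trans[OF pos assms(2)[OF that]] .
    have "real (Suc n) * ln K - ln (fact n) = ln (K ^ Suc n / fact n)"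
      using \<open>K > 0\<close> by (simp add: ln_div ln_mult ln_realpow algebra_simps)
    also have "\<dots> \<le> ln (p i n)"
      using assms(2)[OF that, of n] pos p by (subst ln_le_cancel_iff) auto
    finally have 1: "real (Suc n) * ln K - ln (fact n) \<le> ln (p i n)" .
    have 2: "ln (fact n :: real) \<le> real n * real n"
    proof (cases "n = 0")
      case False
      have "ln (fact n :: real) \<le> ln (real n ^ n)"
        using False fact_le_power[of n, where 'a=real] by (subst ln_le_cancel_iff) auto
      also have "\<dots> = real n * ln (real n)"
        by (simp add: ln_realpow)
      also have "\<dots> \<le> real n * real n"
        using False by (intro mult_left_mono) (auto intro: less_imp_le ln_less_self)
      finally show ?thesis .
    qed simp
    have 3: "- (real (Suc n) * ln K) \<le> (real n + 1) * \<bar>ln K\<bar>"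
      using mult_left_mono[of "- ln K" "\<bar>ln K\<bar>" "real (Suc n)"] by (simp add: algebra_simps)
    have "ln (p i n) \<le> 0"
      using p assms(3)[OF that] by simp
    then show ?thesis
      using 1 2 3 that by simp
  qed
qed

lemma fact_small_majorant:
  assumes "fact_small I x"
  shows "\<exists>M. summable M \<and> (\<forall>i\<in>I. \<forall>n. \<bar>x i n\<bar> \<le> M n)"
proof -
  obtain K where K: "K \<ge> 1" "\<And>i n. i \<in> I \<Longrightarrow> \<bar>fact n * x i n\<bar> \<le> K ^ Suc n"
    using exp_boundedE[OF assms[unfolded fact_small_def]] by metis
  have "summable (\<lambda>n. K * (K ^ n /\<^sub>R fact n))"
    by (intro summable_mult summable_exp_generic)
  moreover have "\<bar>x i n\<bar> \<le> K * (K ^ n /\<^sub>R fact n)" if "i \<in> I" for i n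
    using K(2)[OF that, of n] by (simp add: abs_mult field_simps)
  ultimately show ?thesis
    by blast
qed

lemma fact_small_summable:
  assumes "fact_small I x" "i \<in> I"
  shows "summable (x i)"
proof -
  obtain M where M: "summable M \<and> (\<forall>i\<in>I. \<forall>n. \<bar>x i n\<bar> \<le> M n)"
    using fact_small_majorant[OF assms(1)] ..
  show ?thesis
  proof (rule summable_comparison_test')
    show "summable M"
      using M by simp
    show "norm (x i n) \<le> M n" if "n \<ge> 0" for n
      using M assms(2) by simp
  qed
qed

lemma fact_small_uniformly_convergent:
  assumes "fact_small I x"
  shows "uniformly_convergent_on I (\<lambda>n i. \<Sum>k<n. x i k)"
proof -
  obtain M where M: "summable M \<and> (\<forall>i\<in>I. \<forall>n. \<bar>x i n\<bar> \<le> M n)"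
    using fact_small_majorant[OF assms(1)] ..
  show ?thesis
  proof (rule Weierstrass_m_test')
    show "summable M"
      using M by simp
    show "norm (x i n) \<le> M n" if "i \<in> I" for i n
      using M that by simp
  qed
qed

lemma has_field_derivative_suminf_fact_small:
  fixes x x' :: "real \<Rightarrow> nat \<Rightarrow> real"
  assumes "fact_small {a..b} x" "fact_small {a..b} x'"
    and "\<And>s n. s \<in> {a..b} \<Longrightarrow> ((\<lambda>s. x s n) has_field_derivative x' s n) (at s)"
    and "a < s" "s < b"
  shows "((\<lambda>s. \<Sum>n. x s n) has_field_derivative (\<Sum>n. x' s n)) (at s)"
proof (rule has_field_derivative_series'(2)[where S = "{a..b}" and x0 = s and f' = "\<lambda>n s. x' s n"])
  show "uniformly_convergent_on {a..b} (\<lambda>n s. \<Sum>i<n. x' s i)"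
    using assms(2) by (rule fact_small_uniformly_convergent)
  show "summable (x s)"
    using fact_small_summable[OF assms(1), of s] assms(4,5) by simp
  show "((\<lambda>s. x s n) has_field_derivative x' t n) (at t within {a..b})" if "t \<in> {a..b}" for n t
    using assms(3)[OF that] by (rule has_field_derivative_at_within)
  show "s \<in> {a..b}" "s \<in> interior {a..b}"
    using assms(4,5) by auto
qed simp

lemma fact_small_summation_by_parts:
  assumes "fact_small I u" "exp_bounded I y" "i \<in> I"
  shows "(\<Sum>n. bdiff (u i) n * y i n)
    = (\<Sum>n. u i n * (y i n - y i (Suc n)))"
proof -
  have 1: "summable (\<lambda>n. u i n * y i n)"
    using fact_small_summable[OF fact_small_mult[OF assms(1,2)] assms(3)] .
  have 2: "summable (\<lambda>n. u i n * y i (Suc n))"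
    using fact_small_summable[OF fact_small_mult[OF assms(1) exp_bounded_Suc[OF assms(2)]] assms(3)] .
  define v where "v n = rshift (u i) n * y i n" for n
  have 3: "summable v"
    using 2 by (subst summable_Suc_iff[symmetric]) (simp add: v_def)
  have "(\<Sum>n. bdiff (u i) n * y i n) = (\<Sum>n. u i n * y i n - v n)"
    by (rule suminf_cong) (simp add: v_def bdiff_def algebra_simps)
  also have "\<dots> = (\<Sum>n. u i n * y i n) - suminf v"
    using 1 3 by (rule suminf_diff[symmetric])
  also have "suminf v = (\<Sum>n. v (Suc n))"
    using 3 by (subst suminf_split_head) (auto simp: v_def)
  also have "(\<Sum>n. u i n * y i n) - (\<Sum>n. v (Suc n)) = (\<Sum>n. u i n * y i n - v (Suc n))"
    using 1 2 by (intro suminf_diff) (auto simp: v_def)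
  also have "\<dots> = (\<Sum>n. u i n * (y i n - y i (Suc n)))"
    by (rule suminf_cong) (simp add: v_def bdiff_def algebra_simps)
  finally show ?thesis .
qed

section \<open>Thinning and Poisson noise acting on sequences\<close>

text \<open>
  A single sequence is a family over the one-element index type.
\<close>

abbreviation rapid :: "(nat \<Rightarrow> real) \<Rightarrow> bool" where
  "rapid \<mu> \<equiv> fact_small (UNIV :: unit set) (\<lambda>_. \<mu>)"

lemma rapid_imp_fact_small: "rapid \<mu> \<Longrightarrow> fact_small I (\<lambda>_. \<mu>)"
  by (simp add: fact_small_def exp_bounded_def)

lemma rapidI_power: "rapid (\<lambda>w. K ^ w / fact w)"
  unfolding fact_small_def
proof (rule exp_boundedI)
  fix n :: nat
  have "\<bar>K\<bar> ^ n \<le> max 1 \<bar>K\<bar> ^ n"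
    by (intro power_mono) auto
  also have "\<dots> \<le> max 1 \<bar>K\<bar> ^ Suc n"
    by (intro power_increasing) auto
  finally show "\<bar>fact n * (K ^ n / fact n)\<bar> \<le> max 1 \<bar>K\<bar> ^ Suc n"
    by (simp add: abs_mult power_abs)
qed

text \<open>
  \<open>kern l a w j\<close> is the probability that the sum of independent binomial \<open>(w, a)\<close> and Poisson
  \<open>((1 - a) l)\<close> variables equals \<open>j\<close>. The recursion adds one Bernoulli variable at a time, so the
  identities below are inductions on \<open>w\<close> and avoid binomial sums.
\<close>

fun kern :: "real \<Rightarrow> real \<Rightarrow> nat \<Rightarrow> nat \<Rightarrow> real" where
  "kern l a 0 = (\<lambda>j. exp (- ((1 - a) * l)) * ((1 - a) * l) ^ j / fact j)"
| "kern l a (Suc w) = (\<lambda>j. (1 - a) * kern l a w j + a * rshift (kern l a w) j)"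

lemma kern_nonneg:
  assumes "0 \<le> a" "a \<le> 1" "0 \<le> l"
  shows "0 \<le> kern l a w j"
proof (induction w arbitrary: j)
  case (Suc w)
  then show ?case
    using assms by (cases j) auto
qed (use assms in simp)

lemma kern_pos:
  assumes "0 < a" "a < 1" "0 < l"
  shows "0 < kern l a w j"
proof (induction w arbitrary: j)
  case (Suc w)
  then show ?case
    using assms by (cases j) (auto intro: add_pos_pos)
qed (use assms in simp)

lemma poisson_weight_le_1:
  fixes c :: real
  assumes "0 \<le> c"
  shows "exp (- c) * c ^ j / fact j \<le> 1"
proof (cases "c = 0")
  case False
  then show ?thesis
    using pmf_le_1[of "poisson_pmf c" j] assms by (simp add: mult_ac)
qed (simp add: power_0_left)

lemma kern_le_1:
  assumes "0 \<le> a" "a \<le> 1" "0 \<le> l"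
  shows "kern l a w j \<le> 1"
proof (induction w arbitrary: j)
  case 0
  then show ?case
    using poisson_weight_le_1[of "(1 - a) * l" j] assms by simp
next
  case (Suc w)
  have "rshift (kern l a w) j \<le> 1"
    using Suc by (cases j) auto
  then have "(1 - a) * kern l a w j + a * rshift (kern l a w) j \<le> (1 - a) * 1 + a * 1"
    using assms Suc by (intro add_mono mult_left_mono) auto
  then show ?case
    by simp
qed

lemma kern_ge:
  assumes "0 \<le> a" "a \<le> 1" "0 \<le> l"
  shows "(1 - a) ^ w * kern l a 0 j \<le> kern l a w j"
proof (induction w)
  case (Suc w)
  have "(1 - a) * ((1 - a) ^ w * kern l a 0 j) \<le> (1 - a) * kern l a w j"
    using assms Suc by (intro mult_left_mono) auto
  moreover have "0 \<le> a * rshift (kern l a w) j"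
    using assms by (cases j) (auto intro!: mult_nonneg_nonneg kern_nonneg)
  ultimately show ?case
    by (simp add: mult.assoc)
qed simp

lemma kern_diff: "kern l a w j - kern l a (Suc w) j = a * bdiff (kern l a w) j"
  by (simp add: bdiff_def algebra_simps)

lemma exp_term_Suc: "real (Suc j) * (x ^ Suc j / fact (Suc j)) = x * (x ^ j / fact j)"
  by (simp add: field_simps del: of_nat_Suc)

text \<open>
  The size-bias identity \<open>E (X f(X)) = a w E f(X' + 1) + (1 - a) l E f(X + 1)\<close> for \<open>X\<close> with law
  \<open>kern l a w\<close> and \<open>X'\<close> with one Bernoulli variable less: each Bernoulli variable contributes its mean
  with itself set to \<open>1\<close>, and the Poisson variable contributes its mean with a point added.
\<close>

lemma kern_index:
  "real (Suc j) * kern l a w (Suc j) = a * real w * kern l a (w - 1) j + (1 - a) * l * kern l a w j"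
proof (induction w arbitrary: j)
  case 0
  show ?case
    using arg_cong[OF exp_term_Suc[of j "(1 - a) * l"], of "\<lambda>x. exp (- ((1 - a) * l)) * x"]
    by (simp add: mult_ac del: of_nat_Suc fact_Suc power_Suc)
next
  case (Suc w)
  have *: "a * (real w * kern l a w i) = a * (real w * ((1 - a) * kern l a (w - 1) i + a * rshift (kern l a (w - 1)) i))" for i
    by (cases w) auto
  have 1: "real j * kern l a w j = a * real w * rshift (kern l a (w - 1)) j + (1 - a) * l * rshift (kern l a w) j"
    using Suc.IH[of "j - 1"] by (cases j) auto
  have "real (Suc j) * kern l a (Suc w) (Suc j)
      = (1 - a) * (real (Suc j) * kern l a w (Suc j)) + a * (real j * kern l a w j) + a * kern l a w j"
    by (simp add: algebra_simps)
  also have "\<dots> = a * (real w * ((1 - a) * kern l a (w - 1) j + a * rshift (kern l a (w - 1)) j))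
      + a * kern l a w j + (1 - a) * l * kern l a (Suc w) j"
    unfolding Suc.IH[of j] 1 by (simp add: algebra_simps)
  also have "\<dots> = a * real (Suc w) * kern l a w j + (1 - a) * l * kern l a (Suc w) j"
    unfolding *[symmetric] by (simp add: algebra_simps)
  finally show ?case
    by simp
qed

lemma kern_0_deriv:
  "((\<lambda>a. kern l a 0 j) has_field_derivative l * bdiff (kern l a 0) j) (at a)"
proof (cases j)
  case 0
  then show ?thesis
    by (auto intro!: derivative_eq_intros simp: bdiff_def)
next
  case (Suc i)
  let ?e = "exp (- ((1 - a) * l))" and ?c = "(1 - a) * l"
  have "((\<lambda>a. exp (- ((1 - a) * l)) * ((1 - a) * l) ^ Suc i) has_field_derivative
      (l * ?e * ?c ^ Suc i - ?e * (real (Suc i) * ?c ^ i * l))) (at a)"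
    by (auto intro!: derivative_eq_intros simp del: power_Suc of_nat_Suc simp: algebra_simps)
  then have *: "((\<lambda>a. exp (- ((1 - a) * l)) * ((1 - a) * l) ^ Suc i / fact (Suc i)) has_field_derivative
      (l * ?e * ?c ^ Suc i - ?e * (real (Suc i) * ?c ^ i * l)) / fact (Suc i)) (at a)"
    by (rule DERIV_cdivide)
  have "real (Suc i) * y / fact (Suc i) = y / fact i" for y :: real
    by (simp add: field_simps del: of_nat_Suc)
  from this[of "?e * ?c ^ i * l"]
  have "(l * ?e * ?c ^ Suc i - ?e * (real (Suc i) * ?c ^ i * l)) / fact (Suc i)
      = l * (?e * ?c ^ Suc i / fact (Suc i) - ?e * ?c ^ i / fact i)"
    by (simp add: diff_divide_distrib right_diff_distrib mult_ac del: power_Suc fact_Suc of_nat_Suc)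
  with * show ?thesis
    unfolding Suc bdiff_def kern.simps rshift_Suc by simp
qed

text \<open>
  Raising \<open>a\<close> turns failures into successes at rate \<open>w\<close> and removes Poisson points at rate \<open>l\<close>;
  either changes the sum by one, hence the differences.
\<close>

lemma kern_deriv:
  "((\<lambda>a. kern l a w j) has_field_derivative
      l * bdiff (kern l a w) j - real w * bdiff (kern l a (w - 1)) j) (at a)"
proof (induction w arbitrary: j)
  case 0
  then show ?case
    using kern_0_deriv[of l j a] by simp
next
  case (Suc w)
  \<comment> \<open>The derivative of the recursion defining \<open>kern\<close> is the stated expression because
    differencing commutes with the recursion and \<open>w kern l a (w - 1)\<close> may be expanded by it for all \<open>w\<close>,
    the factor \<open>w\<close> covering \<open>w = 0\<close>.\<close>
  define k' where "k' j = l * bdiff (kern l a w) j - real w * bdiff (kern l a (w - 1)) j" for j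
  have 1: "((\<lambda>a. rshift (kern l a w) j) has_field_derivative rshift k' j) (at a)"
    using Suc.IH[of "j - 1"] by (cases j) (auto simp: k'_def)
  have 2: "((\<lambda>a. kern l a w j) has_field_derivative k' j) (at a)"
    using Suc.IH[of j] by (simp add: k'_def)
  have "real w * bdiff (kern l a w) j
      = (1 - a) * (real w * bdiff (kern l a (w - 1)) j) + a * (real w * rshift (bdiff (kern l a (w - 1))) j)"
    by (cases w; cases j; cases "j - 1") (auto simp: bdiff_def algebra_simps)
  moreover have B: "bdiff (kern l a (Suc w)) j = (1 - a) * bdiff (kern l a w) j + a * rshift (bdiff (kern l a w)) j"
    by (cases j; cases "j - 1") (auto simp: bdiff_def algebra_simps)
  moreover have C: "rshift k' j = l * rshift (bdiff (kern l a w)) j - real w * rshift (bdiff (kern l a (w - 1))) j"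
    by (cases j) (auto simp: k'_def)
  ultimately have eq: "(1 - a) * k' j - kern l a w j + (a * rshift k' j + rshift (kern l a w) j)
      = l * bdiff (kern l a (Suc w)) j - real (Suc w) * bdiff (kern l a (Suc w - 1)) j"
    unfolding B C k'_def diff_Suc_1 of_nat_Suc distrib_right mult_1
    by (simp add: right_diff_distrib distrib_left left_diff_distrib bdiff_def[of "kern l a w" j])
  show ?case
    unfolding kern.simps
    by (rule derivative_eq_intros 1 2 refl)+ (use eq in \<open>simp add: algebra_simps\<close>)
qed

text \<open>
  If \<open>\<mu>\<close> is the mass function of a variable, this is that of its thinning plus independent
  Poisson noise. Signed sequences are needed as well, since differences and drifts are fed back into it.
\<close>

definition flow :: "real \<Rightarrow> real \<Rightarrow> (nat \<Rightarrow> real) \<Rightarrow> nat \<Rightarrow> real" where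
  "flow l a \<mu> j = (\<Sum>w. \<mu> w * kern l a w j)"

text \<open>
  For the mass function of a law with mean \<open>l\<close> this is \<open>l\<close> times the difference between the
  size-biased law moved down by one and the law itself; it vanishes exactly for the Poisson law.
\<close>

definition drift :: "real \<Rightarrow> (nat \<Rightarrow> real) \<Rightarrow> nat \<Rightarrow> real" where
  "drift l \<mu> w = real (Suc w) * \<mu> (Suc w) - l * \<mu> w"

lemma rapid_weighted_Suc:
  assumes "rapid \<mu>"
  shows "rapid (\<lambda>w. real (Suc w) * \<mu> (Suc w))"
proof -
  have "rapid (\<lambda>w. real w * \<mu> w)"
    using assms by (rule fact_small_mult'[OF exp_bounded_nat])
  then show ?thesis
    by (rule fact_small_Suc)
qed

lemma rapid_drift: "rapid \<mu> \<Longrightarrow> rapid (drift l \<mu>)"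
  unfolding drift_def
  by (intro fact_small_diff rapid_weighted_Suc fact_small_mult'[OF exp_bounded_const])

context
  fixes l :: real
  assumes l: "0 \<le> l"
begin

lemma exp_bounded_kern: "exp_bounded {0..1} (\<lambda>a w. kern l a w j)"
  by (rule exp_boundedI[where K = 1]) (use l kern_nonneg kern_le_1 in force)

lemma exp_bounded_bdiff_kern: "exp_bounded {0..1} (\<lambda>a w. bdiff (kern l a w) j)"
proof (cases j)
  case 0
  then show ?thesis
    using exp_bounded_kern[of 0] by (simp add: bdiff_def)
next
  case (Suc i)
  then show ?thesis
    using exp_bounded_diff[OF exp_bounded_kern exp_bounded_kern] by (simp add: bdiff_def)
qed

lemma flow_terms_small: "rapid \<mu> \<Longrightarrow> fact_small {0..1} (\<lambda>a w. \<mu> w * kern l a w j)"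
  by (intro fact_small_mult exp_bounded_kern) (rule rapid_imp_fact_small)

context
  fixes a :: real
  assumes a: "a \<in> {0..1}"
begin

lemma flow_sums: "rapid \<mu> \<Longrightarrow> (\<lambda>w. \<mu> w * kern l a w j) sums flow l a \<mu> j"
  unfolding flow_def using fact_small_summable[OF flow_terms_small a] by (rule summable_sums)

lemma bdiff_flow_sums:
  assumes "rapid \<mu>"
  shows "(\<lambda>w. \<mu> w * bdiff (kern l a w) j) sums bdiff (flow l a \<mu>) j"
proof (cases j)
  case 0
  then show ?thesis
    using flow_sums[OF assms, of 0] by (simp add: bdiff_def)
next
  case (Suc i)
  then show ?thesis
    using sums_diff[OF flow_sums[OF assms, of "Suc i"] flow_sums[OF assms, of i]]
    by (simp add: bdiff_def right_diff_distrib)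
qed

lemma flow_linear:
  assumes "rapid \<mu>" "rapid \<nu>"
  shows "flow l a (\<lambda>w. \<mu> w - c * \<nu> w) j = flow l a \<mu> j - c * flow l a \<nu> j"
  using sums_diff[OF flow_sums[OF assms(1), of j] sums_mult[OF flow_sums[OF assms(2), of j], of c]]
  by (simp add: flow_def sums_iff algebra_simps)

lemma flow_cmult:
  assumes "rapid \<mu>"
  shows "flow l a (\<lambda>w. c * \<mu> w) j = c * flow l a \<mu> j"
  using sums_mult[OF flow_sums[OF assms(1), of j], of c] by (simp add: flow_def sums_iff algebra_simps)

lemma flow_index:
  assumes "rapid \<mu>"
  shows "real (Suc j) * flow l a \<mu> (Suc j)
    = a * flow l a (\<lambda>w. real (Suc w) * \<mu> (Suc w)) j + (1 - a) * l * flow l a \<mu> j"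
proof -
  have "(\<lambda>w. real (Suc w) * \<mu> (Suc w) * kern l a w j) sums flow l a (\<lambda>w. real (Suc w) * \<mu> (Suc w)) j"
    by (rule flow_sums[OF rapid_weighted_Suc[OF assms]])
  then have "(\<lambda>w. real w * \<mu> w * kern l a (w - 1) j) sums flow l a (\<lambda>w. real (Suc w) * \<mu> (Suc w)) j"
    by (intro sums_Suc_imp[of "\<lambda>w. real w * \<mu> w * kern l a (w - 1) j"]) simp_all
  from sums_add[OF sums_mult[OF this, of a] sums_mult[OF flow_sums[OF assms, of j], of "(1 - a) * l"]]
  have "(\<lambda>w. \<mu> w * (real (Suc j) * kern l a w (Suc j))) sums
      (a * flow l a (\<lambda>w. real (Suc w) * \<mu> (Suc w)) j + (1 - a) * l * flow l a \<mu> j)"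
    unfolding kern_index by (simp add: algebra_simps)
  moreover have "(\<lambda>w. \<mu> w * (real (Suc j) * kern l a w (Suc j))) sums (real (Suc j) * flow l a \<mu> (Suc j))"
    using sums_mult[OF flow_sums[OF assms, of "Suc j"], of "real (Suc j)"] by (simp add: mult_ac)
  ultimately show ?thesis
    by (metis sums_unique2)
qed

lemma flow_drift:
  assumes "rapid \<mu>"
  shows "real (Suc j) * flow l a \<mu> (Suc j) - l * flow l a \<mu> j = a * flow l a (drift l \<mu>) j"
proof -
  have *: "flow l a (drift l \<mu>) j = flow l a (\<lambda>w. real (Suc w) * \<mu> (Suc w)) j - l * flow l a \<mu> j"
    unfolding drift_def by (rule flow_linear[OF rapid_weighted_Suc[OF assms] assms])
  show ?thesis
    unfolding * flow_index[OF assms] by (simp add: algebra_simps del: of_nat_Suc)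
qed

text \<open>
  One more trial shifts the law of the count by one with probability \<open>a\<close>. This is \<open>kern_diff\<close>,
  and summation by parts moves the difference from \<open>kern\<close> to \<open>\<mu>\<close>.
\<close>

lemma flow_bdiff:
  assumes "rapid \<mu>"
  shows "flow l a (bdiff \<mu>) j = a * bdiff (flow l a \<mu>) j"
proof -
  have "flow l a (bdiff \<mu>) j = (\<Sum>w. \<mu> w * (kern l a w j - kern l a (Suc w) j))"
    unfolding flow_def
    by (rule fact_small_summation_by_parts[OF rapid_imp_fact_small[OF assms] exp_bounded_kern a])
  also have "\<dots> = (\<Sum>w. a * (\<mu> w * bdiff (kern l a w) j))"
    unfolding kern_diff by (simp add: mult_ac)
  also have "\<dots> = a * bdiff (flow l a \<mu>) j"
    using sums_mult[OF bdiff_flow_sums[OF assms, of j], of a] by (simp add: sums_iff)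
  finally show ?thesis .
qed

lemma flow_nonneg:
  assumes "rapid \<mu>" "\<And>w. 0 \<le> \<mu> w"
  shows "0 \<le> flow l a \<mu> j"
  unfolding flow_def using a l assms(2)
  by (intro suminf_nonneg fact_small_summable[OF flow_terms_small[OF assms(1)] a] mult_nonneg_nonneg kern_nonneg) auto

text \<open>
  Under \<open>flow_index\<close> the sequence \<open>K^w / w!\<close> satisfies a first-order recursion in \<open>j\<close> with ratio
  \<open>(a K + (1 - a) l) / (j + 1)\<close>: thinned Poisson plus Poisson is Poisson.
\<close>

lemma flow_poisson:
  assumes "0 \<le> K"
  shows "flow l a (\<lambda>w. K ^ w / fact w) j \<le> exp K * (K + l) ^ j / fact j"
proof (induction j)
  case 0
  have "flow l a (\<lambda>w. K ^ w / fact w) 0 \<le> (\<Sum>w. K ^ w /\<^sub>R fact w)"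
    unfolding flow_def
  proof (rule suminf_le)
    show "K ^ w / fact w * kern l a w 0 \<le> K ^ w /\<^sub>R fact w" for w
      using mult_left_mono[OF kern_le_1[of a l w 0], of "K ^ w / fact w"] a l assms
      by (simp add: field_simps)
    show "summable (\<lambda>w. K ^ w / fact w * kern l a w 0)"
      by (rule fact_small_summable[OF flow_terms_small[OF rapidI_power] a])
  qed (rule summable_exp_generic)
  then show ?case
    by (simp add: exp_def)
next
  case (Suc j)
  let ?F = "flow l a (\<lambda>w. K ^ w / fact w)"
  have "real (Suc w) * (K ^ Suc w / fact (Suc w)) = K * (K ^ w / fact w)" for w
    using exp_term_Suc[of w K] by simp
  then have "real (Suc j) * ?F (Suc j) = (a * K + (1 - a) * l) * ?F j"
    using flow_index[OF rapidI_power, of j K] flow_cmult[OF rapidI_power[of K], of K j]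
    by (simp add: algebra_simps del: of_nat_Suc fact_Suc power_Suc)
  also have "\<dots> \<le> (K + l) * (exp K * (K + l) ^ j / fact j)"
  proof (rule mult_mono)
    show "a * K + (1 - a) * l \<le> K + l"
      using a l assms by (intro add_mono) (auto intro: mult_left_le_one_le)
    show "0 \<le> ?F j"
      using assms by (intro flow_nonneg rapidI_power) auto
  qed (use l assms Suc in auto)
  also have "\<dots> = real (Suc j) * (exp K * (K + l) ^ Suc j / fact (Suc j))"
    using exp_term_Suc[of j "K + l"]
    by (metis (no_types, opaque_lifting) mult.left_commute times_divide_eq_right)
  finally show ?case
    by (rule mult_left_le_imp_le) simp
qed

end

text \<open>
  Every rapidly decaying sequence is dominated by a multiple of \<open>K^w / w!\<close>, for which
  \<open>flow_poisson\<close> gives a bound that does not depend on \<open>a\<close>.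
\<close>

lemma fact_small_flow:
  assumes "rapid \<mu>"
  shows "fact_small {0..1} (\<lambda>a. flow l a \<mu>)"
proof -
  obtain K where K: "K \<ge> 1" "\<And>w. \<bar>fact w * \<mu> w\<bar> \<le> K ^ Suc w"
    using exp_boundedE[OF assms[unfolded fact_small_def]] by (metis UNIV_I)
  have \<mu>: "\<bar>\<mu> w\<bar> \<le> K * (K ^ w / fact w)" for w
    using K(2)[of w] by (simp add: abs_mult field_simps)
  show ?thesis
  proof (rule fact_small_mono)
    show "fact_small {0..1::real} (\<lambda>_ j. K * exp K * ((K + l) ^ j / fact j))"
      by (rule fact_small_mult'[OF exp_bounded_const rapid_imp_fact_small[OF rapidI_power]])
    show "a \<in> {0..1} \<and> \<bar>flow l a \<mu> j\<bar> \<le> \<bar>K * exp K * ((K + l) ^ j / fact j)\<bar>" if a: "a \<in> {0..1}" for a j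
    proof -
      obtain M where M: "summable M \<and> (\<forall>a\<in>{0..1}. \<forall>w. \<bar>\<mu> w * kern l a w j\<bar> \<le> M w)"
        using fact_small_majorant[OF flow_terms_small[OF assms]] ..
      have abs_summable: "summable (\<lambda>w. \<bar>\<mu> w * kern l a w j\<bar>)"
        by (rule summable_comparison_test'[of M 0]) (use M a in auto)
      have "\<bar>flow l a \<mu> j\<bar> \<le> (\<Sum>w. \<bar>\<mu> w * kern l a w j\<bar>)"
        unfolding flow_def by (rule summable_rabs[OF abs_summable])
      also have "\<dots> \<le> (\<Sum>w. K * (K ^ w / fact w * kern l a w j))"
      proof (rule suminf_le)
        show "\<bar>\<mu> w * kern l a w j\<bar> \<le> K * (K ^ w / fact w * kern l a w j)" for w
          using mult_right_mono[OF \<mu>[of w] kern_nonneg[of a l w j]] a l kern_nonneg[of a l w j]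
          by (simp add: abs_mult mult_ac)
        show "summable (\<lambda>w. K * (K ^ w / fact w * kern l a w j))"
          by (intro summable_mult sums_summable[OF flow_sums[OF a rapidI_power]])
      qed (rule abs_summable)
      also have "\<dots> = K * flow l a (\<lambda>w. K ^ w / fact w) j"
        using sums_mult[OF flow_sums[OF a rapidI_power[of K], of j], of K] by (simp add: sums_iff)
      also have "\<dots> \<le> K * (exp K * (K + l) ^ j / fact j)"
        using K(1) flow_poisson[OF a, of K j] by (intro mult_left_mono) auto
      also have "\<dots> \<le> \<bar>K * exp K * ((K + l) ^ j / fact j)\<bar>"
        by (metis abs_ge_self mult.assoc times_divide_eq_right)
      finally show ?thesis
        using a by simp
    qed
  qed
qed

lemma flow_deriv:
  assumes "rapid \<mu>" "0 < a" "a < 1"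
  shows "((\<lambda>a. flow l a \<mu> j) has_field_derivative - bdiff (flow l a (drift l \<mu>)) j) (at a)"
proof -
  let ?x' = "\<lambda>a w. \<mu> w * (l * bdiff (kern l a w) j - real w * bdiff (kern l a (w - 1)) j)"
  have a: "a \<in> {0..1}"
    using assms by auto
  have "fact_small {0..1} ?x'"
    by (intro fact_small_mult rapid_imp_fact_small[OF assms(1)] exp_bounded_diff exp_bounded_mult
        exp_bounded_const exp_bounded_nat exp_bounded_bdiff_kern exp_bounded_pred[OF exp_bounded_bdiff_kern])
  then have "((\<lambda>a. flow l a \<mu> j) has_field_derivative suminf (?x' a)) (at a)"
    unfolding flow_def using assms
    by (intro has_field_derivative_suminf_fact_small[OF flow_terms_small[OF assms(1)]] DERIV_cmult kern_deriv)
  moreover have "?x' a sums - bdiff (flow l a (drift l \<mu>)) j"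
  proof -
    have "(\<lambda>w. real (Suc w) * \<mu> (Suc w) * bdiff (kern l a w) j) sums
        (bdiff (flow l a (\<lambda>w. real (Suc w) * \<mu> (Suc w))) j)"
      by (rule bdiff_flow_sums[OF a rapid_weighted_Suc[OF assms(1)]])
    then have "(\<lambda>w. real w * \<mu> w * bdiff (kern l a (w - 1)) j) sums
        (bdiff (flow l a (\<lambda>w. real (Suc w) * \<mu> (Suc w))) j)"
      by (intro sums_Suc_imp[of "\<lambda>w. real w * \<mu> w * bdiff (kern l a (w - 1)) j"]) simp_all
    from sums_diff[OF sums_mult[OF bdiff_flow_sums[OF a assms(1), of j], of l] this]
    have "?x' a sums (l * bdiff (flow l a \<mu>) j - bdiff (flow l a (\<lambda>w. real (Suc w) * \<mu> (Suc w))) j)"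
      by (simp add: algebra_simps)
    moreover have *: "flow l a (drift l \<mu>) i = flow l a (\<lambda>w. real (Suc w) * \<mu> (Suc w)) i - l * flow l a \<mu> i" for i
      unfolding drift_def by (rule flow_linear[OF a rapid_weighted_Suc[OF assms(1)] assms(1)])
    have "bdiff (flow l a (drift l \<mu>)) j
        = bdiff (flow l a (\<lambda>w. real (Suc w) * \<mu> (Suc w))) j - l * bdiff (flow l a \<mu>) j"
      by (cases j) (simp_all add: bdiff_def * algebra_simps del: of_nat_Suc)
    ultimately show ?thesis
      by simp
  qed
  ultimately show ?thesis
    by (simp add: sums_iff)
qed

end

section \<open>Logarithmic inequalities\<close>

text \<open>
  With \<open>x = A C / B\<^sup>2\<close> the right-hand side equals
  \<open>(A + C) (1/x - 1 + ln x) + 2 B (x - 1 - ln x)\<close>, and both brackets are nonnegative by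
  \<open>ln y \<le> y - 1\<close>. In the application \<open>A\<close>, \<open>B\<close>, \<open>C\<close> are three consecutive values of the density of
  the interpolating law with respect to the Poisson law.
\<close>

lemma ln_ratio_ineq:
  fixes A B C :: real
  assumes "0 < A" "0 < B" "0 < C"
  shows "0 \<le> (A - 2 * B + C) * (ln A - 2 * ln B + ln C)
    + (B - A)\<^sup>2 / A - 2 * ((B - A) * (C - B) / B) + (C - B)\<^sup>2 / C"
proof -
  define x where "x = A * C / B\<^sup>2"
  have x: "0 < x"
    using assms by (simp add: x_def)
  have ln_x: "ln x = ln A - 2 * ln B + ln C"
    using assms by (simp add: x_def ln_div ln_mult ln_realpow)
  have 1: "0 \<le> 1 / x - 1 + ln x"
    using ln_le_minus_one[of "1 / x"] x by (simp add: ln_div)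
  have 2: "0 \<le> x - 1 - ln x"
    using ln_le_minus_one[of x] x by simp
  have "0 \<le> (A + C) * (1 / x - 1 + ln x) + 2 * B * (x - 1 - ln x)"
    using assms by (intro add_nonneg_nonneg[OF mult_nonneg_nonneg[OF _ 1] mult_nonneg_nonneg[OF _ 2]]) auto
  also have "\<dots> = (A - 2 * B + C) * ln x + ((A + C) * (1 / x - 1) + 2 * B * (x - 1))"
    by (simp add: algebra_simps)
  also have "(A + C) * (1 / x - 1) + 2 * B * (x - 1)
      = (B - A)\<^sup>2 / A - 2 * ((B - A) * (C - B) / B) + (C - B)\<^sup>2 / C"
    using assms by (simp add: x_def field_simps power2_eq_square)
  finally show ?thesis
    unfolding ln_x by (simp add: algebra_simps)
qed

definition lnstep :: "nat \<Rightarrow> real" where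
  "lnstep j = ln (real (Suc (Suc j))) - ln (real (Suc j))"

lemma lnstep_strict_antimono: "lnstep (Suc j) < lnstep j"
proof -
  have "ln (real (j + 3) * real (j + 1)) < ln (real (j + 2) * real (j + 2))"
    by (subst ln_less_cancel_iff) (auto simp: algebra_simps intro!: add_pos_nonneg)
  then show ?thesis
    by (simp add: lnstep_def ln_mult eval_nat_numeral)
qed

text \<open>
  The sequence \<open>j ln (1 + 1/j)\<close> increases. Applying \<open>ln y \<le> y - 1\<close> to \<open>(j+1)/(j+2)\<close> and to
  \<open>(j+1)\<^sup>2 / (j (j+2))\<close>, the error terms cancel exactly.
\<close>

lemma lnstep_weighted_mono: "real j * lnstep (j - 1) \<le> real (Suc j) * lnstep j"
proof (cases j)
  case 0
  then show ?thesis
    by (simp add: lnstep_def)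
next
  case (Suc i)
  define x where "x = real j"
  have x: "x > 0"
    using Suc by (simp add: x_def)
  have 1: "1 - (x + 1) / (x + 2) \<le> ln (x + 2) - ln (x + 1)"
    using ln_le_minus_one[of "(x + 1) / (x + 2)"] x by (simp add: ln_div)
  have "ln ((x + 1)\<^sup>2 / (x * (x + 2))) \<le> (x + 1)\<^sup>2 / (x * (x + 2)) - 1"
    using x by (intro ln_le_minus_one) auto
  then have "1 - (x + 1)\<^sup>2 / (x * (x + 2)) \<le> ln x + ln (x + 2) - 2 * ln (x + 1)"
    using x by (simp add: ln_div ln_mult ln_realpow)
  from mult_left_mono[OF this, of x] x
  have 2: "x - (x + 1)\<^sup>2 / (x + 2) \<le> x * (ln x + ln (x + 2) - 2 * ln (x + 1))"
    by (simp add: right_diff_distrib)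
  have "x - (x + 1)\<^sup>2 / (x + 2) + (1 - (x + 1) / (x + 2)) = 0"
    using x by (simp add: field_simps power2_eq_square)
  with 1 2 have "0 \<le> x * (ln x + ln (x + 2) - 2 * ln (x + 1)) + (ln (x + 2) - ln (x + 1))"
    by linarith
  moreover have *: "lnstep (j - 1) = ln (x + 1) - ln x" "lnstep j = ln (x + 2) - ln (x + 1)" "real (Suc j) = x + 1"
    by (simp_all add: lnstep_def x_def Suc add_ac)
  ultimately show ?thesis
    unfolding * x_def[symmetric] by (simp add: algebra_simps)
qed

lemma exp_bounded_ln_Suc: "exp_bounded I (\<lambda>_ j. ln (real (Suc j)))"
proof (rule exp_bounded_mono)
  show "exp_bounded I (\<lambda>_ j. real j + 1)"
    by (rule exp_bounded_add[OF exp_bounded_nat exp_bounded_const])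
  show "i \<in> I \<and> \<bar>ln (real (Suc j))\<bar> \<le> \<bar>real j + 1\<bar>" if "i \<in> I" for i j
    using ln_add_one_self_le_self[of "real j"] that by simp
qed

lemma exp_bounded_lnstep: "exp_bounded I (\<lambda>_. lnstep)"
  unfolding lnstep_def
  by (rule exp_bounded_diff[OF exp_bounded_Suc[OF exp_bounded_ln_Suc] exp_bounded_ln_Suc])

section \<open>The entropy along the interpolation\<close>

text \<open>
  The assumptions on \<open>P\<close> used in the analytic part. The last one, together with \<open>R \<ge> 0\<close>, encodes the stochastic order:
  \<open>R w\<close> is \<open>l\<close> times the difference of the distribution functions of the size-biased law at \<open>w + 1\<close>
  and of \<open>W\<close> at \<open>w\<close>.
\<close>

locale size_bias_dominated =
  fixes l :: real and P R :: "nat \<Rightarrow> real"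
  assumes l_pos: "0 < l"
    and P_nonneg: "\<And>w. 0 \<le> P w" and P_sums: "P sums 1" and rapid_P: "rapid P"
    and R_nonneg: "\<And>w. 0 \<le> R w" and rapid_R: "rapid R"
    and drift_eq: "drift l P = bdiff R"
begin

abbreviation p :: "real \<Rightarrow> nat \<Rightarrow> real" where
  "p a \<equiv> flow l a P"

abbreviation r :: "real \<Rightarrow> nat \<Rightarrow> real" where
  "r a \<equiv> flow l a (drift l P)"

abbreviation t :: "real \<Rightarrow> nat \<Rightarrow> real" where
  "t a \<equiv> flow l a (drift l (drift l P))"

lemma l_nonneg: "0 \<le> l"
  using l_pos by simp

lemmas rapid_drift_P = rapid_drift[OF rapid_P]
lemmas rapid_drift2_P = rapid_drift[OF rapid_drift_P]

lemma P_support: obtains w where "0 < P w"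
proof -
  have "\<exists>w. P w \<noteq> 0"
  proof (rule ccontr)
    assume "\<nexists>w. P w \<noteq> 0"
    then have "P = (\<lambda>_. 0)"
      by auto
    then show False
      using P_sums sums_unique2[of "\<lambda>_. 0::real" 0 1] by simp
  qed
  then show ?thesis
    using that P_nonneg by (metis less_eq_real_def)
qed

lemma p_le_1:
  assumes "a \<in> {0..1}"
  shows "p a j \<le> 1"
proof (rule sums_le)
  show "(\<lambda>w. P w * kern l a w j) sums p a j"
    by (rule flow_sums[OF l_nonneg assms rapid_P])
  show "P sums 1"
    by (rule P_sums)
  show "P w * kern l a w j \<le> P w" for w
    using assms l_pos P_nonneg[of w] by (intro mult_left_le kern_le_1) auto
qed

lemma p_ge_term:
  assumes "a \<in> {0..1}"
  shows "P w * kern l a w j \<le> p a j"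
proof -
  have "(\<Sum>v\<in>{w}. P v * kern l a v j) \<le> p a j"
    unfolding flow_def
  proof (rule sum_le_suminf)
    show "summable (\<lambda>v. P v * kern l a v j)"
      using flow_sums[OF l_nonneg assms rapid_P] by (rule sums_summable)
    show "0 \<le> P v * kern l a v j" for v
      using assms l_pos P_nonneg[of v] by (intro mult_nonneg_nonneg kern_nonneg) auto
  qed auto
  then show ?thesis
    by simp
qed

lemma p_pos:
  assumes "0 < a" "a < 1"
  shows "0 < p a j"
proof -
  obtain w where "0 < P w"
    by (rule P_support)
  then have "0 < P w * kern l a w j"
    using assms l_pos by (simp add: kern_pos)
  also have "\<dots> \<le> p a j"
    using assms by (intro p_ge_term) auto
  finally show ?thesis .
qed

text \<open>
  The event that all trials fail leaves only the Poisson noise, whose mean \<open>(1 - a) l\<close> stays away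
  from \<open>0\<close> for \<open>a \<le> b < 1\<close>.
\<close>

lemma p_lower_bound:
  assumes "b < 1"
  shows "\<exists>K>0. \<forall>a\<in>{0..b}. \<forall>j. K ^ Suc j / fact j \<le> p a j"
proof -
  obtain w where w: "0 < P w"
    by (rule P_support)
  define c where "c = P w * ((1 - b) ^ w * exp (- l))"
  define d where "d = (1 - b) * l"
  have cd: "0 < c" "0 < d"
    using w assms l_pos by (auto simp: c_def d_def)
  have "min c d ^ Suc j / fact j \<le> p a j" if "a \<in> {0..b}" for a j
  proof -
    have a: "0 \<le> a" "a \<le> b" "a \<in> {0..1}"
      using that assms by auto
    have "min c d ^ Suc j / fact j \<le> c * d ^ j / fact j"
      using cd by (auto intro!: divide_right_mono mult_mono power_mono)
    also have "\<dots> = P w * ((1 - b) ^ w * (exp (- l) * d ^ j / fact j))"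
      by (simp add: c_def)
    also have "\<dots> \<le> P w * ((1 - a) ^ w * kern l a 0 j)"
      unfolding kern.simps d_def
    proof (intro mult_left_mono mult_mono power_mono divide_right_mono)
      show "exp (- l) \<le> exp (- ((1 - a) * l))"
        using a l_pos by simp
    qed (use a assms l_pos w in auto)
    also have "\<dots> \<le> P w * kern l a w j"
      using w a assms l_pos by (intro mult_left_mono kern_ge) auto
    also have "\<dots> \<le> p a j"
      using a by (intro p_ge_term) auto
    finally show ?thesis .
  qed
  then show ?thesis
    using cd by (intro exI[of _ "min c d"]) auto
qed

context
  fixes b :: real
  assumes b: "b < 1"
begin

lemma small_on: "fact_small {0..1} x \<Longrightarrow> fact_small {0..b} x"
  using b by (elim fact_small_mono) auto

lemma small_flow: "rapid \<mu> \<Longrightarrow> fact_small {0..b} (\<lambda>a. flow l a \<mu>)"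
  by (rule small_on[OF fact_small_flow[OF l_nonneg]])

lemma exp_bounded_ln_p: "exp_bounded {0..b} (\<lambda>a j. ln (p a j))"
proof -
  obtain K where "0 < K" "\<forall>a\<in>{0..b}. \<forall>j. K ^ Suc j / fact j \<le> p a j"
    using p_lower_bound[OF b] by blast
  then show ?thesis
    using b p_le_1 by (intro exp_bounded_ln[of K]) auto
qed

lemma exp_bounded_div_p: "fact_small {0..b} x \<Longrightarrow> exp_bounded {0..b} (\<lambda>a j. x a j / p a j)"
proof -
  assume x: "fact_small {0..b} x"
  obtain K where "0 < K" "\<forall>a\<in>{0..b}. \<forall>j. K ^ Suc j / fact j \<le> p a j"
    using p_lower_bound[OF b] by blast
  then show ?thesis
    by (intro exp_bounded_div[OF x, of K]) auto
qed

end

definition entropy_at where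
  "entropy_at a = - (\<Sum>j. p a j * ln (p a j))"

text \<open>
  Termwise derivatives of \<open>entropy_at\<close>, with \<open>p' = - bdiff r\<close> and \<open>p'' = bdiff (bdiff t)\<close> inserted.
\<close>

definition entropy_deriv where
  "entropy_deriv a = (\<Sum>j. bdiff (r a) j * (ln (p a j) + 1))"

definition entropy_deriv2 where
  "entropy_deriv2 a = - (\<Sum>j. bdiff (bdiff (t a)) j * (ln (p a j) + 1) + bdiff (r a) j * (bdiff (r a) j / p a j))"

lemma p_deriv: "0 < a \<Longrightarrow> a < 1 \<Longrightarrow> ((\<lambda>a. p a j) has_field_derivative - bdiff (r a) j) (at a)"
  by (rule flow_deriv[OF l_nonneg rapid_P])

lemma r_deriv:
  assumes "0 < a" "a < 1"
  shows "((\<lambda>a. bdiff (r a) j) has_field_derivative - bdiff (bdiff (t a)) j) (at a)"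
proof -
  have *: "((\<lambda>a. r a i) has_field_derivative - bdiff (t a) i) (at a)" for i
    by (rule flow_deriv[OF l_nonneg rapid_drift_P assms])
  show ?thesis
  proof (cases j)
    case 0
    then show ?thesis
      using *[of 0] by (simp add: bdiff_def)
  next
    case (Suc i)
    show ?thesis
      unfolding Suc bdiff_def[of _ "Suc i"] rshift_Suc
      by (rule DERIV_cong[OF DERIV_diff[OF *[of "Suc i"] *[of i]]]) (simp add: bdiff_def)
  qed
qed

lemma entropy_at_deriv:
  assumes a: "0 < a" "a < 1"
  shows "(entropy_at has_field_derivative entropy_deriv a) (at a)"
proof -
  define x b where "x = a / 2" and "b = (1 + a) / 2"
  have xb: "0 < x" "x < a" "a < b" "b < 1"
    using a by (auto simp: x_def b_def)
  have sub: "i \<in> {0..b}" if "i \<in> {x..b}" for i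
    using that xb by auto
  have "((\<lambda>a. \<Sum>j. p a j * ln (p a j)) has_field_derivative
      (\<Sum>j. - (bdiff (r a) j * (ln (p a j) + 1)))) (at a)"
  proof (rule has_field_derivative_suminf_fact_small[where a = x and b = b])
    have "fact_small {0..b} (\<lambda>a j. p a j * ln (p a j))"
      by (intro fact_small_mult small_flow exp_bounded_ln_p rapid_P xb)
    then show "fact_small {x..b} (\<lambda>a j. p a j * ln (p a j))"
      by (rule fact_small_mono) (use sub in auto)
    have "fact_small {0..b} (\<lambda>a j. - (bdiff (r a) j * (ln (p a j) + 1)))"
      by (intro fact_small_minus fact_small_mult fact_small_bdiff small_flow exp_bounded_add
          exp_bounded_const exp_bounded_ln_p rapid_drift_P xb)
    then show "fact_small {x..b} (\<lambda>a j. - (bdiff (r a) j * (ln (p a j) + 1)))"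
      by (rule fact_small_mono) (use sub in auto)
    show "((\<lambda>a. p a j * ln (p a j)) has_field_derivative - (bdiff (r s) j * (ln (p s j) + 1))) (at s)"
      if "s \<in> {x..b}" for s j
    proof -
      have s: "0 < s" "s < 1"
        using that xb by auto
      show ?thesis
        using p_pos[OF s, of j]
        by (auto intro!: derivative_eq_intros p_deriv[OF s] simp: field_simps)
    qed
  qed (use xb in auto)
  moreover have "summable (\<lambda>j. bdiff (r a) j * (ln (p a j) + 1))"
  proof -
    have "fact_small {0..b} (\<lambda>a j. bdiff (r a) j * (ln (p a j) + 1))"
      by (intro fact_small_mult fact_small_bdiff small_flow exp_bounded_add
          exp_bounded_const exp_bounded_ln_p rapid_drift_P xb)
    then show ?thesis
      by (rule fact_small_summable) (use xb a in auto)
  qed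
  ultimately have "((\<lambda>a. \<Sum>j. p a j * ln (p a j)) has_field_derivative - entropy_deriv a) (at a)"
    by (simp add: entropy_deriv_def suminf_minus)
  from DERIV_minus[OF this] show ?thesis
    unfolding entropy_at_def[abs_def] by simp
qed

lemma entropy_deriv_deriv:
  assumes a: "0 < a" "a < 1"
  shows "(entropy_deriv has_field_derivative entropy_deriv2 a) (at a)"
proof -
  define x b where "x = a / 2" and "b = (1 + a) / 2"
  have xb: "0 < x" "x < a" "a < b" "b < 1"
    using a by (auto simp: x_def b_def)
  have sub: "i \<in> {0..b}" if "i \<in> {x..b}" for i
    using that xb by auto
  let ?f = "\<lambda>a j. bdiff (bdiff (t a)) j * (ln (p a j) + 1) + bdiff (r a) j * (bdiff (r a) j / p a j)"
  have f: "fact_small {0..b} ?f"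
    by (intro fact_small_add fact_small_mult fact_small_bdiff small_flow exp_bounded_add exp_bounded_div_p
        exp_bounded_const exp_bounded_ln_p rapid_drift_P rapid_drift2_P xb)
  have "(entropy_deriv has_field_derivative (\<Sum>j. - ?f a j)) (at a)"
    unfolding entropy_deriv_def[abs_def]
  proof (rule has_field_derivative_suminf_fact_small[where a = x and b = b])
    have "fact_small {0..b} (\<lambda>a j. bdiff (r a) j * (ln (p a j) + 1))"
      by (intro fact_small_mult fact_small_bdiff small_flow exp_bounded_add
          exp_bounded_const exp_bounded_ln_p rapid_drift_P xb)
    then show "fact_small {x..b} (\<lambda>a j. bdiff (r a) j * (ln (p a j) + 1))"
      by (rule fact_small_mono) (use sub in auto)
    show "fact_small {x..b} (\<lambda>a j. - ?f a j)"
      using fact_small_minus[OF f] by (rule fact_small_mono) (use sub in auto)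
    show "((\<lambda>a. bdiff (r a) j * (ln (p a j) + 1)) has_field_derivative - ?f s j) (at s)"
      if "s \<in> {x..b}" for s j
    proof -
      have s: "0 < s" "s < 1"
        using that xb by auto
      show ?thesis
        using p_pos[OF s, of j]
        by (auto intro!: derivative_eq_intros p_deriv[OF s] r_deriv[OF s] simp: field_simps)
    qed
  qed (use xb in auto)
  moreover have "summable (?f a)"
    using f by (rule fact_small_summable) (use xb a in auto)
  ultimately show ?thesis
    by (simp only: entropy_deriv2_def suminf_minus)
qed

context
  fixes a :: real
  assumes a: "0 < a" "a < 1"
begin

lemma a_in: "a \<in> {0..a}" "a \<in> {0..1}"
  using a by auto

text \<open>
  Since \<open>r = a \<cdot> bdiff V\<close> with \<open>V \<ge> 0\<close>, summation by parts gives
  \<open>\<Sum> r \<phi> = - a \<Sum> V\<^sub>j (\<phi>\<^sub>j\<^sub>+\<^sub>1 - \<phi>\<^sub>j)\<close>. If it vanishes then so does \<open>V 0\<close>, which is a sum of the \<open>R w\<close> with positive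
  coefficients. Both equality cases of the theorem rest on this.
\<close>

lemma drift_against_increasing:
  assumes "exp_bounded {0..a} (\<lambda>_. \<phi>)" "\<And>j. \<phi> j < \<phi> (Suc j)"
  shows "(\<Sum>j. r a j * \<phi> j) \<le> 0"
    and "(\<Sum>j. r a j * \<phi> j) = 0 \<Longrightarrow> drift l P = (\<lambda>_. 0)"
proof -
  let ?V = "flow l a R"
  have V: "fact_small {0..a} (\<lambda>a. flow l a R)"
    using a by (intro small_flow rapid_R)
  have V_nonneg: "0 \<le> ?V j" for j
    by (rule flow_nonneg[OF l_nonneg a_in(2) rapid_R R_nonneg])
  have "(\<Sum>j. r a j * \<phi> j) = (\<Sum>j. a * (bdiff ?V j * \<phi> j))"
    unfolding drift_eq flow_bdiff[OF l_nonneg a_in(2) rapid_R] by (simp add: mult.assoc)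
  also have "\<dots> = a * (\<Sum>j. bdiff ?V j * \<phi> j)"
  proof (rule suminf_mult)
    show "summable (\<lambda>j. bdiff ?V j * \<phi> j)"
      using fact_small_summable[OF fact_small_mult[OF fact_small_bdiff[OF V] assms(1)] a_in(1)] .
  qed
  also have "(\<Sum>j. bdiff ?V j * \<phi> j) = (\<Sum>j. ?V j * (\<phi> j - \<phi> (Suc j)))"
    by (rule fact_small_summation_by_parts[OF V assms(1) a_in(1)])
  also have "\<dots> = - (\<Sum>j. ?V j * (\<phi> (Suc j) - \<phi> j))"
  proof -
    have sm: "summable (\<lambda>j. ?V j * (\<phi> (Suc j) - \<phi> j))"
      using fact_small_summable[OF fact_small_mult[OF V exp_bounded_diff[OF exp_bounded_Suc[OF assms(1)] assms(1)]] a_in(1)] .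
    show ?thesis
      unfolding suminf_minus[OF sm, symmetric] by (simp add: algebra_simps)
  qed
  finally have eq: "(\<Sum>j. r a j * \<phi> j) = - (a * (\<Sum>j. ?V j * (\<phi> (Suc j) - \<phi> j)))"
    by simp
  have sm: "summable (\<lambda>j. ?V j * (\<phi> (Suc j) - \<phi> j))"
    using fact_small_summable[OF fact_small_mult[OF V exp_bounded_diff[OF exp_bounded_Suc[OF assms(1)] assms(1)]] a_in(1)] .
  have nonneg: "0 \<le> ?V j * (\<phi> (Suc j) - \<phi> j)" for j
    using V_nonneg assms(2)[of j] by (intro mult_nonneg_nonneg) auto
  show "(\<Sum>j. r a j * \<phi> j) \<le> 0"
    unfolding eq using a suminf_nonneg[OF sm nonneg] by simp
  show "drift l P = (\<lambda>_. 0)" if "(\<Sum>j. r a j * \<phi> j) = 0"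
  proof -
    have "(\<Sum>j. ?V j * (\<phi> (Suc j) - \<phi> j)) = 0"
      using that a unfolding eq by simp
    then have "?V 0 * (\<phi> (Suc 0) - \<phi> 0) = 0"
      using suminf_eq_zero_iff[OF sm nonneg] by blast
    then have "?V 0 = 0"
      using assms(2)[of 0] by simp
    moreover have "summable (\<lambda>w. R w * kern l a w 0)"
      using flow_sums[OF l_nonneg a_in(2) rapid_R] by (rule sums_summable)
    moreover have "0 \<le> R w * kern l a w 0" for w
      using kern_pos[OF a l_pos, of w 0] R_nonneg[of w] by simp
    ultimately have "R w * kern l a w 0 = 0" for w
      unfolding flow_def by (subst (asm) suminf_eq_zero_iff) auto
    then have "R w = 0" for w
      using kern_pos[OF a l_pos, of w 0] by (metis less_irrefl mult_eq_0_iff)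
    then have "bdiff R = (\<lambda>_. 0)"
      by (auto simp: bdiff_def rshift_def fun_eq_iff)
    then show ?thesis
      by (simp add: drift_eq)
  qed
qed

lemma r_eq: "a * r a j = real (Suc j) * p a (Suc j) - l * p a j"
  using flow_drift[OF l_nonneg a_in(2) rapid_P] by simp

lemma t_eq: "a * t a j = real (Suc j) * r a (Suc j) - l * r a j"
  using flow_drift[OF l_nonneg a_in(2) rapid_drift_P] by simp

text \<open>
  Splitting \<open>ln p\<^sub>j - ln p\<^sub>j\<^sub>+\<^sub>1\<close> into \<open>ln ((j+1) / l)\<close>, which increases in \<open>j\<close>, and minus the logarithm of
  \<open>(j+1) p\<^sub>j\<^sub>+\<^sub>1 / (l p\<^sub>j)\<close>, which has the same sign as \<open>r\<^sub>j\<close>.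
\<close>

lemma entropy_deriv_sign:
  "entropy_deriv a \<le> 0" "entropy_deriv a = 0 \<Longrightarrow> drift l P = (\<lambda>_. 0)"
proof -
  define \<phi> where "\<phi> j = ln (real (Suc j)) - ln l" for j
  define L where "L j = ln (real (Suc j) * p a (Suc j)) - ln (l * p a j)" for j
  have r: "fact_small {0..a} (\<lambda>a. r a)"
    using a by (intro small_flow rapid_drift_P)
  have lnp: "exp_bounded {0..a} (\<lambda>a j. ln (p a j))"
    using a by (intro exp_bounded_ln_p)
  have \<phi>: "exp_bounded {0..a} (\<lambda>_. \<phi>)"
    unfolding \<phi>_def by (rule exp_bounded_diff[OF exp_bounded_ln_Suc exp_bounded_const])
  have "entropy_deriv a = (\<Sum>j. r a j * ((ln (p a j) + 1) - (ln (p a (Suc j)) + 1)))"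
    unfolding entropy_deriv_def
    using fact_small_summation_by_parts[OF r exp_bounded_add[OF lnp exp_bounded_const] a_in(1)] .
  also have "\<dots> = (\<Sum>j. r a j * (ln (p a j) - ln (p a (Suc j))))"
    by simp
  finally have by_parts: "entropy_deriv a = (\<Sum>j. r a j * (ln (p a j) - ln (p a (Suc j))))" .
  have L: "ln (p a j) - ln (p a (Suc j)) = \<phi> j - L j" for j
    using p_pos[OF a, of j] p_pos[OF a, of "Suc j"] l_pos by (simp add: \<phi>_def L_def ln_mult del: of_nat_Suc)
  have sm1: "summable (\<lambda>j. r a j * \<phi> j)"
    using fact_small_summable[OF fact_small_mult[OF r \<phi>] a_in(1)] .
  have "summable (\<lambda>j. r a j * (ln (p a j) - ln (p a (Suc j))))"
    using fact_small_summable[OF fact_small_mult[OF r exp_bounded_diff[OF lnp exp_bounded_Suc[OF lnp]]] a_in(1)] .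
  from summable_diff[OF sm1 this] have sm2: "summable (\<lambda>j. r a j * L j)"
    unfolding L by (simp add: algebra_simps)
  have split: "entropy_deriv a = (\<Sum>j. r a j * \<phi> j) - (\<Sum>j. r a j * L j)"
    unfolding by_parts L suminf_diff[OF sm1 sm2] by (simp add: algebra_simps)
  have "0 \<le> r a j * L j" for j
  proof -
    have "0 < real (Suc j) * p a (Suc j)" "0 < l * p a j"
      using p_pos[OF a] l_pos by (simp_all del: of_nat_Suc)
    then have "0 \<le> (a * r a j) * L j"
      unfolding r_eq L_def
      by (cases "real (Suc j) * p a (Suc j) \<le> l * p a j") (auto intro: mult_nonneg_nonneg mult_nonpos_nonpos simp del: of_nat_Suc)
    then show ?thesis
      using mult_le_cancel_left_pos[of a 0 "r a j * L j"] a by (simp add: mult.assoc)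
  qed
  then have nonneg: "0 \<le> (\<Sum>j. r a j * L j)"
    by (intro suminf_nonneg sm2)
  have mono: "\<phi> j < \<phi> (Suc j)" for j
    by (simp add: \<phi>_def)
  show "entropy_deriv a \<le> 0"
    using drift_against_increasing(1)[OF \<phi> mono] nonneg split by simp
  show "drift l P = (\<lambda>_. 0)" if "entropy_deriv a = 0"
    using drift_against_increasing[OF \<phi> mono] nonneg split that by linarith
qed

text \<open>
  Up to the factor \<open>l\<^sup>2 / a\<^sup>2\<close> this is \<open>ln_ratio_ineq\<close> for the density
  \<open>g\<^sub>j = p\<^sub>j j! / l^j\<close> at \<open>j\<close>, \<open>j + 1\<close>, \<open>j + 2\<close>, rescaled by its factor \<open>l^j / j!\<close>: up to positive factors,
  \<open>r\<close> is then a first and \<open>t\<close> a second difference of \<open>g\<close>.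
\<close>

lemma second_order_term_nonneg:
  "0 \<le> t a j * (ln (p a j) - 2 * ln (p a (Suc j)) + ln (p a (Suc (Suc j))) + lnstep j)
    + (r a j * (r a j / p a j) - 2 * (r a j * (r a (Suc j) / p a (Suc j)))
      + real (Suc j) / real (Suc (Suc j)) * (r a (Suc j) * (r a (Suc j) / p a (Suc (Suc j)))))"
proof -
  define n where "n = real (Suc j)"
  have n: "0 < n" "real (Suc (Suc j)) = n + 1"
    by (auto simp: n_def)
  \<comment> \<open>The density \<open>p\<^sub>i i! / l^i\<close> at \<open>i = j, j + 1, j + 2\<close>, each multiplied by \<open>l^j / j!\<close>.\<close>
  define A B C where "A = p a j" and "B = n * p a (Suc j) / l" and "C = n * (n + 1) * p a (Suc (Suc j)) / l\<^sup>2"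
  have pos: "0 < A" "0 < B" "0 < C"
    using p_pos[OF a] l_pos n by (auto simp: A_def B_def C_def)
  have p: "p a j = A" "p a (Suc j) = l * B / n" "p a (Suc (Suc j)) = l\<^sup>2 * C / n / (n + 1)"
    using n l_pos by (auto simp: A_def B_def C_def)
  have r0: "r a j = l * (B - A) / a"
    using r_eq[of j] a n by (simp add: p n_def[symmetric] field_simps del: of_nat_Suc)
  have "(n + 1) * (l\<^sup>2 * C / n / (n + 1)) = l\<^sup>2 * C / n"
    using n by simp
  then have r1: "r a (Suc j) = l\<^sup>2 * (C - B) / (a * n)"
    using r_eq[of "Suc j"] a n(1) unfolding n(2) p by (simp add: field_simps power2_eq_square)
  have "n * (l\<^sup>2 * (C - B) / (a * n)) = l\<^sup>2 * (C - B) / a"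
    using n(1) a by simp
  then have t: "t a j = l\<^sup>2 / a\<^sup>2 * (A - 2 * B + C)"
    using t_eq[of j] a unfolding n_def[symmetric] r0 r1 by (simp add: field_simps power2_eq_square)
  have G: "ln (p a j) - 2 * ln (p a (Suc j)) + ln (p a (Suc (Suc j))) + lnstep j = ln A - 2 * ln B + ln C"
    unfolding p lnstep_def n(2) n_def[symmetric]
    using pos n l_pos by (simp add: ln_mult ln_div ln_realpow)
  have distribute: "k * (x * y + u - v + w) = k * x * y + (k * u - k * v + k * w)" for k x y u v w :: real
    by (simp add: algebra_simps)
  have "0 \<le> l\<^sup>2 / a\<^sup>2 * ((A - 2 * B + C) * (ln A - 2 * ln B + ln C)
      + (B - A)\<^sup>2 / A - 2 * ((B - A) * (C - B) / B) + (C - B)\<^sup>2 / C)"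
    by (rule mult_nonneg_nonneg[OF _ ln_ratio_ineq[OF pos]]) simp
  also have "\<dots> = l\<^sup>2 / a\<^sup>2 * (A - 2 * B + C) * (ln A - 2 * ln B + ln C)
      + (l\<^sup>2 / a\<^sup>2 * ((B - A)\<^sup>2 / A) - l\<^sup>2 / a\<^sup>2 * (2 * ((B - A) * (C - B) / B)) + l\<^sup>2 / a\<^sup>2 * ((C - B)\<^sup>2 / C))"
    by (rule distribute)
  also have "l\<^sup>2 / a\<^sup>2 * ((B - A)\<^sup>2 / A) = r a j * (r a j / p a j)"
    unfolding r0 p using pos a l_pos n by (simp add: field_simps power2_eq_square)
  also have "l\<^sup>2 / a\<^sup>2 * (2 * ((B - A) * (C - B) / B)) = 2 * (r a j * (r a (Suc j) / p a (Suc j)))"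
    unfolding r0 r1 p using pos a l_pos n by (simp add: field_simps power2_eq_square)
  also have "l\<^sup>2 / a\<^sup>2 * ((C - B)\<^sup>2 / C)
      = real (Suc j) / real (Suc (Suc j)) * (r a (Suc j) * (r a (Suc j) / p a (Suc (Suc j))))"
  proof -
    have "x / m * (y * (y / (z / x / m))) = x\<^sup>2 * y\<^sup>2 / z" if "m > 0" "x > 0" for x y z m :: real
      using that by (simp add: field_simps power2_eq_square)
    from this[of "n + 1" n "l\<^sup>2 * (C - B) / (a * n)" "l\<^sup>2 * C"] n(1)
    have "n / (n + 1) * (l\<^sup>2 * (C - B) / (a * n) * (l\<^sup>2 * (C - B) / (a * n) / (l\<^sup>2 * C / n / (n + 1))))
        = n\<^sup>2 * (l\<^sup>2 * (C - B) / (a * n))\<^sup>2 / (l\<^sup>2 * C)"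
      by simp
    also have "\<dots> = l\<^sup>2 / a\<^sup>2 * ((C - B)\<^sup>2 / C)"
      using pos a l_pos n(1) by (simp add: field_simps power2_eq_square)
    finally show ?thesis
      unfolding r1 p n(2) n_def[symmetric] by simp
  qed
  finally show ?thesis
    unfolding G t .
qed

text \<open>
  Summing by parts twice, \<open>\<Sum> p'' ln p\<close> becomes \<open>\<Sum> t (G - lnstep)\<close>, where \<open>G\<close> is the second
  difference of \<open>ln g\<close>, the logarithm of the density with respect to the Poisson law, and \<open>lnstep\<close>
  that of \<open>ln (j!)\<close>. The \<open>G\<close>-part and \<open>\<Sum> p'\<^sup>2 / p\<close> together are nonnegative by
  \<open>second_order_term_nonneg\<close>; the other part is \<open>1 / a\<close> times a sum of \<open>r\<close> against a strictly increasing sequence.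
\<close>

lemma entropy_deriv2_sign:
  "entropy_deriv2 a \<le> 0" "entropy_deriv2 a = 0 \<Longrightarrow> drift l P = (\<lambda>_. 0)"
proof -
  define \<psi> where "\<psi> j = real j * lnstep (j - 1) - l * lnstep j" for j
  define G where "G j = ln (p a j) - 2 * ln (p a (Suc j)) + ln (p a (Suc (Suc j))) + lnstep j" for j
  have r: "fact_small {0..a} (\<lambda>a. r a)" and t: "fact_small {0..a} (\<lambda>a. t a)"
    using a by (auto intro: small_flow rapid_drift_P rapid_drift2_P)
  have lnp: "exp_bounded {0..a} (\<lambda>a j. ln (p a j) + 1)"
    using a by (intro exp_bounded_add exp_bounded_ln_p exp_bounded_const)
  have rp: "exp_bounded {0..a} (\<lambda>a j. r a j / p a j)"
    using a by (intro exp_bounded_div_p r)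
  have rp': "exp_bounded {0..a} (\<lambda>a j. r a j / p a (Suc j))"
    using exp_bounded_Suc[OF exp_bounded_div_p[OF a(2) fact_small_rshift[OF r]]] by simp
  have brp: "exp_bounded {0..a} (\<lambda>a j. bdiff (r a) j / p a j)"
    using a by (intro exp_bounded_div_p fact_small_bdiff r)
  note summ = fact_small_summable[OF _ a_in(1)]

  have sm_tpsi: "summable (\<lambda>j. t a j * lnstep j)"
    using summ[OF fact_small_mult[OF t exp_bounded_lnstep]] .
  have first: "(\<lambda>j. bdiff (bdiff (t a)) j * (ln (p a j) + 1)) sums
      ((\<Sum>j. t a j * G j) - (\<Sum>j. t a j * lnstep j))"
    and sm_tG: "summable (\<lambda>j. t a j * G j)"
  proof -
    let ?y = "\<lambda>a j. ln (p a j) + 1"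
    have d: "exp_bounded {0..a} (\<lambda>a j. ?y a j - ?y a (Suc j))"
      by (rule exp_bounded_diff[OF lnp exp_bounded_Suc[OF lnp]])
    have "(\<Sum>j. bdiff (bdiff (t a)) j * ?y a j)
        = (\<Sum>j. t a j * ((?y a j - ?y a (Suc j)) - (?y a (Suc j) - ?y a (Suc (Suc j)))))"
      unfolding fact_small_summation_by_parts[OF fact_small_bdiff[OF t] lnp a_in(1)]
      by (rule fact_small_summation_by_parts[OF t d a_in(1)])
    also have "\<dots> = (\<Sum>j. t a j * G j - t a j * lnstep j)"
      by (simp add: G_def algebra_simps)
    finally have eq: "(\<Sum>j. bdiff (bdiff (t a)) j * ?y a j) = (\<Sum>j. t a j * G j - t a j * lnstep j)" .
    have "summable (\<lambda>j. t a j * ((?y a j - ?y a (Suc j)) - (?y a (Suc j) - ?y a (Suc (Suc j)))))"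
      using summ[OF fact_small_mult[OF t exp_bounded_diff[OF d exp_bounded_Suc[OF d]]]] .
    from summable_add[OF this sm_tpsi] show sm_tG: "summable (\<lambda>j. t a j * G j)"
      by (simp add: G_def algebra_simps)
    show "(\<lambda>j. bdiff (bdiff (t a)) j * ?y a j) sums ((\<Sum>j. t a j * G j) - (\<Sum>j. t a j * lnstep j))"
      using summable_sums[OF summ[OF fact_small_mult[OF fact_small_bdiff[OF fact_small_bdiff[OF t]] lnp]]]
      unfolding suminf_diff[OF sm_tG sm_tpsi] eq .
  qed

  \<comment> \<open>In \<open>(r\<^sub>j - r\<^sub>j\<^sub>-\<^sub>1)\<^sup>2 / p\<^sub>j\<close> the part \<open>r\<^sub>j\<^sub>-\<^sub>1\<^sup>2 / p\<^sub>j\<close>, shifted to \<open>W\<^sub>j = r\<^sub>j\<^sup>2 / p\<^sub>j\<^sub>+\<^sub>1\<close>, is divided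
    as \<open>1 / (j+1) + j / (j+1)\<close>. Only the second share (\<open>S4\<close>) is needed by the termwise inequality,
    after a further shift; the first (\<open>S3\<close>) is nonnegative and dropped.\<close>
  define W where "W j = r a j * (r a j / p a (Suc j))" for j
  define S1 where "S1 = (\<Sum>j. r a j * (r a j / p a j))"
  define S2 where "S2 = (\<Sum>j. r a j * (r a (Suc j) / p a (Suc j)))"
  define S3 where "S3 = (\<Sum>j. W j / real (Suc j))"
  define S4 where "S4 = (\<Sum>j. real j / real (Suc j) * W j)"
  have s1: "(\<lambda>j. r a j * (r a j / p a j)) sums S1"
    unfolding S1_def using summ[OF fact_small_mult[OF r rp]] by (rule summable_sums)
  have s2: "(\<lambda>j. r a j * (r a (Suc j) / p a (Suc j))) sums S2"
    unfolding S2_def using summ[OF fact_small_mult[OF r exp_bounded_Suc[OF rp]]] by (rule summable_sums)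
  have eb3: "exp_bounded {0..a} (\<lambda>_ j. 1 / real (Suc j))"
    by (rule exp_bounded_mono[OF exp_bounded_const[of "{0..a}" 1]]) (simp add: field_simps)
  have eb4: "exp_bounded {0..a} (\<lambda>_ j. real j / real (Suc j))"
    by (rule exp_bounded_mono[OF exp_bounded_const[of "{0..a}" 1]]) (simp add: field_simps)
  have s3: "(\<lambda>j. W j / real (Suc j)) sums S3"
    unfolding S3_def W_def
    using summable_sums[OF summ[OF fact_small_mult[OF fact_small_mult[OF r rp'] eb3]]] by simp
  have s4: "(\<lambda>j. real j / real (Suc j) * W j) sums S4"
    unfolding S4_def W_def
    using summable_sums[OF summ[OF fact_small_mult'[OF eb4 fact_small_mult[OF r rp']]]] .
  have "(\<lambda>j. W j / real (Suc j) + real j / real (Suc j) * W j) sums (S3 + S4)"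
    by (rule sums_add[OF s3 s4])
  moreover have "W j / real (Suc j) + real j / real (Suc j) * W j = W j" for j
  proof -
    have "W j / real (Suc j) + real j / real (Suc j) * W j = W j * ((1 + real j) / real (Suc j))"
      by (simp only: distrib_left add_divide_distrib) (simp del: of_nat_Suc)
    then show ?thesis
      by simp
  qed
  ultimately have W: "W sums (S3 + S4)"
    by simp
  have s4': "(\<lambda>j. real (Suc j) / real (Suc (Suc j)) * W (Suc j)) sums S4"
    using sums_Suc_iff[of "\<lambda>j. real j / real (Suc j) * W j" S4] s4 by simp
  have s2': "(\<lambda>j. r a j * (rshift (r a) j / p a j)) sums S2"
    using s2 by (intro sums_Suc_imp[of "\<lambda>j. r a j * (rshift (r a) j / p a j)"]) (simp_all add: mult_ac)
  have W': "(\<lambda>j. rshift (r a) j * (rshift (r a) j / p a j)) sums (S3 + S4)"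
    using W by (intro sums_Suc_imp[of "\<lambda>j. rshift (r a) j * (rshift (r a) j / p a j)"]) (simp_all add: W_def[abs_def])
  have "(\<lambda>j. r a j * (r a j / p a j) - 2 * (r a j * (rshift (r a) j / p a j))
      + rshift (r a) j * (rshift (r a) j / p a j)) sums (S1 - 2 * S2 + (S3 + S4))"
    by (intro sums_add sums_diff sums_mult s1 s2' W')
  then have second: "(\<lambda>j. bdiff (r a) j * (bdiff (r a) j / p a j)) sums (S1 - 2 * S2 + (S3 + S4))"
    by (simp add: bdiff_def algebra_simps diff_divide_distrib)

  have main_sums: "(\<lambda>j. t a j * G j + (r a j * (r a j / p a j) - 2 * (r a j * (r a (Suc j) / p a (Suc j)))
      + real (Suc j) / real (Suc (Suc j)) * W (Suc j))) sums ((\<Sum>j. t a j * G j) + (S1 - 2 * S2 + S4))"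
    by (intro sums_add sums_diff sums_mult s1 s2 s4' summable_sums sm_tG)
  have main: "0 \<le> (\<Sum>j. t a j * G j) + (S1 - 2 * S2 + S4)"
  proof (rule sums_le[OF _ sums_zero main_sums])
    show "0 \<le> t a j * G j + (r a j * (r a j / p a j) - 2 * (r a j * (r a (Suc j) / p a (Suc j)))
        + real (Suc j) / real (Suc (Suc j)) * W (Suc j))" for j
      using second_order_term_nonneg[of j] unfolding G_def W_def .
  qed
  have "0 \<le> S3"
  proof (rule sums_le[OF _ sums_zero s3])
    show "0 \<le> W j / real (Suc j)" for j
      using p_pos[OF a, of "Suc j"] by (simp add: W_def)
  qed
  moreover have "entropy_deriv2 a = - ((\<Sum>j. t a j * G j) - (\<Sum>j. t a j * lnstep j) + (S1 - 2 * S2 + (S3 + S4)))"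
    unfolding entropy_deriv2_def using sums_unique[OF sums_add[OF first second]] by simp
  ultimately have upper: "entropy_deriv2 a \<le> (\<Sum>j. t a j * lnstep j)"
    using main by linarith

  have \<psi>: "exp_bounded {0..a} (\<lambda>_. \<psi>)"
    unfolding \<psi>_def
    by (rule exp_bounded_diff[OF exp_bounded_mult[OF exp_bounded_nat exp_bounded_pred[OF exp_bounded_lnstep]]
          exp_bounded_mult[OF exp_bounded_const exp_bounded_lnstep]])
  have mono: "\<psi> j < \<psi> (Suc j)" for j
    using lnstep_weighted_mono[of j] mult_strict_left_mono[OF lnstep_strict_antimono[of j] l_pos]
    by (simp add: \<psi>_def del: of_nat_Suc)
  have "a * (\<Sum>j. t a j * lnstep j) = (\<Sum>j. r a j * \<psi> j)"
  proof -
    have x: "(\<lambda>j. r a j * (real j * lnstep (j - 1))) sums (\<Sum>j. r a j * (real j * lnstep (j - 1)))"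
      using summable_sums[OF summ[OF fact_small_mult[OF r exp_bounded_mult[OF exp_bounded_nat exp_bounded_pred[OF exp_bounded_lnstep]]]]] .
    then have x': "(\<lambda>j. r a (Suc j) * (real (Suc j) * lnstep j)) sums (\<Sum>j. r a j * (real j * lnstep (j - 1)))"
      using sums_Suc_iff[of "\<lambda>j. r a j * (real j * lnstep (j - 1))" "\<Sum>j. r a j * (real j * lnstep (j - 1))"] by simp
    have y: "(\<lambda>j. r a j * (l * lnstep j)) sums (\<Sum>j. r a j * (l * lnstep j))"
      using summable_sums[OF summ[OF fact_small_mult[OF r exp_bounded_mult[OF exp_bounded_const exp_bounded_lnstep]]]] .
    have "a * (t a j * lnstep j) = r a (Suc j) * (real (Suc j) * lnstep j) - r a j * (l * lnstep j)" for j
      using arg_cong[OF t_eq[of j], of "\<lambda>x. x * lnstep j"] by (simp add: algebra_simps del: of_nat_Suc)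
    with sums_diff[OF x' y] have "(\<lambda>j. a * (t a j * lnstep j)) sums
        ((\<Sum>j. r a j * (real j * lnstep (j - 1))) - (\<Sum>j. r a j * (l * lnstep j)))"
      by simp
    moreover have "(\<lambda>j. r a j * \<psi> j) sums ((\<Sum>j. r a j * (real j * lnstep (j - 1))) - (\<Sum>j. r a j * (l * lnstep j)))"
      using sums_diff[OF x y] by (simp add: \<psi>_def right_diff_distrib)
    ultimately show ?thesis
      using suminf_mult[OF sm_tpsi, of a] by (simp add: sums_iff)
  qed
  then have eq: "(\<Sum>j. t a j * lnstep j) = (\<Sum>j. r a j * \<psi> j) / a"
    using a by (simp add: field_simps)
  have le: "(\<Sum>j. r a j * \<psi> j) / a \<le> 0"
    using drift_against_increasing(1)[OF \<psi> mono] a by (simp add: divide_nonpos_pos)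
  show "entropy_deriv2 a \<le> 0"
    using upper le eq by linarith
  show "drift l P = (\<lambda>_. 0)" if "entropy_deriv2 a = 0"
  proof -
    have "(\<Sum>j. r a j * \<psi> j) / a = 0"
      using upper le eq that by linarith
    then show ?thesis
      using a drift_against_increasing(2)[OF \<psi> mono] by simp
  qed
qed

lemma entropy_derivs_zero:
  assumes "drift l P = (\<lambda>_. 0)"
  shows "entropy_deriv a = 0" "entropy_deriv2 a = 0"
proof -
  have "drift l (\<lambda>_. 0) = (\<lambda>_. 0)"
    by (auto simp: drift_def)
  moreover have "flow l a (\<lambda>_. 0) = (\<lambda>_. 0)"
    by (auto simp: flow_def)
  moreover have "bdiff (\<lambda>_. 0) = (\<lambda>_. 0)"
    by (auto simp: bdiff_def rshift_def)
  ultimately show "entropy_deriv a = 0" "entropy_deriv2 a = 0"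
    by (simp_all add: entropy_deriv_def entropy_deriv2_def assms)
qed

end

end

section \<open>From probability laws to their mass functions\<close>

lemma expectation_sums:
  fixes W :: "nat pmf" and f :: "nat \<Rightarrow> real"
  assumes "integrable (measure_pmf W) f"
  shows "(\<lambda>w. pmf W w * f w) sums measure_pmf.expectation W f"
proof -
  have "measure_pmf.expectation W f = (\<integral>w. pmf W w *\<^sub>R f w \<partial>count_space UNIV)"
    by (simp add: measure_pmf_eq_density integral_density)
  moreover have "integrable (count_space UNIV) (\<lambda>w. pmf W w *\<^sub>R f w)"
    using assms by (simp add: measure_pmf_eq_density integrable_density)
  ultimately show ?thesis
    using sums_integral_count_space_nat[of "\<lambda>w. pmf W w *\<^sub>R f w"] by simp
qed

lemma pmf_sums_1: "pmf W sums 1" for W :: "nat pmf"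
  using expectation_sums[of W "\<lambda>_. 1"] by simp

lemma pmf_bind_suminf: "pmf (bind_pmf W f) j = (\<Sum>w. pmf W w * pmf (f w) j)" for W :: "nat pmf"
  unfolding pmf_bind
  by (intro sums_unique expectation_sums measure_pmf.integrable_const_bound[where B = 1] AE_pmfI)
    (auto simp: pmf_le_1)

lemma pmf_binomial_plus_poisson:
  assumes "0 < a" "a < 1" "0 < l"
  shows "pmf (bind_pmf (binomial_pmf w a) (\<lambda>t. bind_pmf (poisson_law ((1 - a) * l)) (\<lambda>z. return_pmf (t + z)))) j
    = kern l a w j"
proof (induction w arbitrary: j)
  case 0
  then show ?case
    using assms by (simp add: poisson_law_def binomial_pmf_0 bind_return_pmf bind_return_pmf' mult_ac)
next
  case (Suc w)
  let ?Y = "bind_pmf (binomial_pmf w a) (\<lambda>t. bind_pmf (poisson_law ((1 - a) * l)) (\<lambda>z. return_pmf (t + z)))"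
  have "bind_pmf (binomial_pmf (Suc w) a) (\<lambda>t. bind_pmf (poisson_law ((1 - a) * l)) (\<lambda>z. return_pmf (t + z)))
      = bind_pmf (bernoulli_pmf a) (\<lambda>b. map_pmf (\<lambda>y. (if b then 1 else 0) + y) ?Y)"
    using assms
    by (simp add: binomial_pmf_Suc bind_assoc_pmf bind_return_pmf map_bind_pmf map_return_pmf add_ac)
  moreover have "pmf (map_pmf Suc ?Y) j = rshift (kern l a w) j"
  proof (cases j)
    case 0
    then show ?thesis
      by (simp add: pmf_eq_0_set_pmf)
  next
    case j: (Suc i)
    then show ?thesis
      using Suc.IH[of i] by (simp add: pmf_map_inj')
  qed
  moreover have "(+) (Suc 0) = Suc" "(+) (0::nat) = id"
    by auto
  ultimately show ?case
    using assms Suc.IH[of j] by (simp add: pmf_bind[of "bernoulli_pmf a"] pmf.map_id)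
qed

lemma pmf_thinned_interp:
  assumes "0 < a" "a < 1" "0 < mean W"
  shows "pmf (thinned_interp W a) j = flow (mean W) a (pmf W) j"
proof -
  have "thinned_interp W a = bind_pmf W (\<lambda>w. bind_pmf (binomial_pmf w a)
      (\<lambda>t. bind_pmf (poisson_law ((1 - a) * mean W)) (\<lambda>z. return_pmf (t + z))))"
    using assms by (simp add: thinned_interp_def thinning_binomial bind_assoc_pmf)
  then show ?thesis
    by (simp only: pmf_bind_suminf[of W] pmf_binomial_plus_poisson[OF assms] flow_def)
qed

lemma prob_lessThan: "measure_pmf.prob W {..<t} = (\<Sum>j<t. pmf W j)" for W :: "nat pmf"
  by (simp add: measure_measure_pmf_finite)

lemma prob_atLeast: "measure_pmf.prob W {t..} = 1 - (\<Sum>j<t. pmf W j)" for W :: "nat pmf"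
proof -
  have "{t..} = UNIV - {..<t}"
    by auto
  then show ?thesis
    using measure_pmf.prob_compl[of "{..<t}" W] by (simp add: prob_lessThan)
qed

context
  fixes W :: "nat pmf"
  assumes int: "integrable (measure_pmf W) real" and mean_pos: "mean W > 0"
    and st: "map_pmf (\<lambda>w. w + 1) W \<ge>\<^sub>s\<^sub>t size_biased W"
begin

lemma mean_sums: "(\<lambda>w. real w * pmf W w) sums mean W"
  using expectation_sums[OF int] by (simp add: mult.commute)

text \<open>
  The stochastic order at level \<open>t\<close>, in terms of complements so that only finite sums occur.
\<close>

lemma partial_mean_ge: "mean W * (\<Sum>j<t. pmf W j) \<le> (\<Sum>j\<le>t. real j * pmf W j)"
proof -
  have "{t<..} = {Suc t..}"
    by auto
  then have "measure_pmf.prob (size_biased W) {t<..} = 1 - (\<Sum>j\<le>t. real j * pmf W j) / mean W"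
    using prob_atLeast[of "size_biased W" "Suc t"]
    by (simp add: pmf_size_biased[OF int mean_pos] lessThan_Suc_atMost flip: sum_divide_distrib)
  moreover have "(\<lambda>w. w + 1) -` {t<..} = {t..}"
    by auto
  then have "measure_pmf.prob (map_pmf (\<lambda>w. w + 1) W) {t<..} = 1 - (\<Sum>j<t. pmf W j)"
    using prob_atLeast[of W t] by (simp add: measure_map_pmf)
  ultimately have "(\<Sum>j<t. pmf W j) \<le> (\<Sum>j\<le>t. real j * pmf W j) / mean W"
    using st[unfolded st_ge_def, rule_format, of t] by simp
  then show ?thesis
    using mean_pos by (simp add: field_simps)
qed

text \<open>
  Replacing every value above \<open>t\<close> by \<open>t + 1\<close> does not increase the mean.
\<close>

lemma partial_mean_le: "(\<Sum>j\<le>t. real j * pmf W j) + real (Suc t) * (1 - (\<Sum>j\<le>t. pmf W j)) \<le> mean W"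
proof (rule sums_le[OF _ _ mean_sums])
  have "(\<lambda>j. real (Suc t) * pmf W j + (if j \<in> {..t} then (real j - real (Suc t)) * pmf W j else 0))
      sums (real (Suc t) * 1 + (\<Sum>j\<in>{..t}. (real j - real (Suc t)) * pmf W j))"
    by (intro sums_add sums_mult pmf_sums_1 sums_If_finite_set) simp
  also have "real (Suc t) * 1 + (\<Sum>j\<in>{..t}. (real j - real (Suc t)) * pmf W j)
      = (\<Sum>j\<le>t. real j * pmf W j) + real (Suc t) * (1 - (\<Sum>j\<le>t. pmf W j))"
    by (simp add: left_diff_distrib right_diff_distrib sum_subtractf sum_distrib_left del: of_nat_Suc)
  finally show "(\<lambda>j. real (Suc t) * pmf W j + (if j \<in> {..t} then (real j - real (Suc t)) * pmf W j else 0))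
      sums ((\<Sum>j\<le>t. real j * pmf W j) + real (Suc t) * (1 - (\<Sum>j\<le>t. pmf W j)))" .
  show "real (Suc t) * pmf W j + (if j \<in> {..t} then (real j - real (Suc t)) * pmf W j else 0)
      \<le> real j * pmf W j" for j
    by (auto simp: left_diff_distrib intro!: mult_right_mono simp del: of_nat_Suc)
qed

lemma partial_sum_le_1: "(\<Sum>j<t. pmf W j) \<le> 1"
  using measure_pmf.prob_le_1[of W "{..<t}"] by (simp add: prob_lessThan)

text \<open>
  The two preceding lemmas give \<open>(t + 1) P(W \<ge> t + 1) \<le> l P(W \<ge> t)\<close>.
\<close>

lemma tail_le: "1 - (\<Sum>j<t. pmf W j) \<le> mean W ^ t / fact t"
proof (induction t)
  case (Suc t)
  have "real (Suc t) * (1 - (\<Sum>j<Suc t. pmf W j)) \<le> mean W * (1 - (\<Sum>j<t. pmf W j))"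
    using partial_mean_le[of t] partial_mean_ge[of t]
    by (simp add: lessThan_Suc_atMost right_diff_distrib del: of_nat_Suc)
  also have "\<dots> \<le> mean W * (mean W ^ t / fact t)"
    using mean_pos Suc by (intro mult_left_mono) auto
  also have "\<dots> = real (Suc t) * (mean W ^ Suc t / fact (Suc t))"
    by (rule exp_term_Suc[symmetric])
  finally show ?case
    by (rule mult_left_le_imp_le) simp
qed simp

lemma rapid_pmf: "rapid (pmf W)"
proof (rule fact_small_mono[OF rapidI_power])
  show "i \<in> UNIV \<and> \<bar>pmf W w\<bar> \<le> \<bar>mean W ^ w / fact w\<bar>" for i w
    using tail_le[of w] partial_sum_le_1[of "Suc w"] mean_pos by simp
qed

text \<open>
  The nonnegative sequence whose differences are the drift.
\<close>

definition excess :: "nat \<Rightarrow> real" where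
  "excess w = (\<Sum>v\<le>w. drift (mean W) (pmf W) v)"

lemma excess_eq: "excess w = (\<Sum>j\<le>Suc w. real j * pmf W j) - mean W * (\<Sum>j<Suc w. pmf W j)"
proof -
  have "(\<Sum>j\<le>Suc w. real j * pmf W j) = (\<Sum>v\<le>w. real (Suc v) * pmf W (Suc v))"
    by (subst sum.atMost_Suc_shift) simp
  then show ?thesis
    by (simp add: excess_def drift_def sum_subtractf sum_distrib_left lessThan_Suc_atMost del: of_nat_Suc)
qed

lemma excess_nonneg: "0 \<le> excess w"
  using partial_mean_ge[of "Suc w"] by (simp add: excess_eq)

lemma rapid_excess: "rapid excess"
proof (rule fact_small_mono)
  show "rapid (\<lambda>w. mean W * (mean W ^ w / fact w))"
    by (rule fact_small_mult'[OF exp_bounded_const rapidI_power])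
  show "i \<in> UNIV \<and> \<bar>excess w\<bar> \<le> \<bar>mean W * (mean W ^ w / fact w)\<bar>" for i w
  proof -
    \<comment> \<open>Only the trivial part of \<open>partial_mean_le\<close> is used here: a partial sum of the mean is at most the mean.\<close>
    have "0 \<le> real (Suc (Suc w)) * (1 - (\<Sum>j\<le>Suc w. pmf W j))"
      using partial_sum_le_1[of "Suc (Suc w)"] by (simp add: lessThan_Suc_atMost del: of_nat_Suc)
    then have "excess w \<le> mean W * (1 - (\<Sum>j<Suc w. pmf W j))"
      using partial_mean_le[of "Suc w"] unfolding excess_eq right_diff_distrib mult_1_right by linarith
    also have "\<dots> \<le> mean W * (1 - (\<Sum>j<w. pmf W j))"
      using mean_pos by (intro mult_left_mono) auto
    also have "\<dots> \<le> mean W * (mean W ^ w / fact w)"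
      using mean_pos tail_le[of w] by (intro mult_left_mono) auto
    finally show ?thesis
      using excess_nonneg[of w] by simp
  qed
qed

lemma size_bias_dominated: "size_bias_dominated (mean W) (pmf W) excess"
proof
  show "drift (mean W) (pmf W) = bdiff excess"
  proof
    fix w show "drift (mean W) (pmf W) w = bdiff excess w"
      by (cases w) (simp_all add: bdiff_def excess_def)
  qed
qed (simp_all add: mean_pos pmf_sums_1 rapid_pmf excess_nonneg rapid_excess)

text \<open>
  The recursion \<open>(j + 1) P (j + 1) = l P j\<close> characterises the Poisson law of mean \<open>l\<close>. Conversely, a
  Poisson law satisfies it with its own parameter, and summing over \<open>j\<close> identifies that parameter
  with the mean.
\<close>

lemma is_poisson_iff_drift_0: "is_poisson W \<longleftrightarrow> drift (mean W) (pmf W) = (\<lambda>_. 0)"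
proof
  assume "is_poisson W"
  then obtain \<mu> where \<mu>: "0 \<le> \<mu>" "W = poisson_law \<mu>"
    by (auto simp: is_poisson_def)
  have "\<mu> \<noteq> 0"
    using mean_pos \<mu>(2) by (auto simp: poisson_law_def)
  then have pmf_W: "pmf W w = exp (- \<mu>) * (\<mu> ^ w / fact w)" for w
    using \<mu> by (simp add: poisson_law_def mult_ac)
  have rec: "real (Suc w) * pmf W (Suc w) = \<mu> * pmf W w" for w
    unfolding pmf_W using arg_cong[OF exp_term_Suc[of w \<mu>], of "\<lambda>x. exp (- \<mu>) * x"] by (simp only: mult.left_commute)
  have "(\<lambda>w. real (Suc w) * pmf W (Suc w)) sums mean W"
    using sums_Suc_iff[of "\<lambda>w. real w * pmf W w" "mean W"] mean_sums by simp
  moreover have "(\<lambda>w. real (Suc w) * pmf W (Suc w)) sums \<mu>"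
    unfolding rec using sums_mult[OF pmf_sums_1[of W], of \<mu>] by simp
  ultimately have "mean W = \<mu>"
    by (rule sums_unique2)
  then show "drift (mean W) (pmf W) = (\<lambda>_. 0)"
    by (simp add: drift_def rec fun_eq_iff del: of_nat_Suc)
next
  assume drift: "drift (mean W) (pmf W) = (\<lambda>_. 0)"
  have pmf_W: "pmf W w = pmf W 0 * (mean W ^ w / fact w)" for w
  proof (induction w)
    case (Suc w)
    have "real (Suc w) * pmf W (Suc w) = mean W * pmf W w"
      using fun_cong[OF drift, of w] by (simp add: drift_def)
    also have "\<dots> = real (Suc w) * (pmf W 0 * (mean W ^ Suc w / fact (Suc w)))"
      unfolding Suc using exp_term_Suc[of w "mean W"] by (metis mult.left_commute)
    finally show ?case
      by (rule mult_left_cancel[THEN iffD1, rotated]) simp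
  qed simp
  have "(\<lambda>w. pmf W 0 * (mean W ^ w /\<^sub>R fact w)) sums (pmf W 0 * exp (mean W))"
    by (intro sums_mult exp_converges)
  moreover have "pmf W 0 * (mean W ^ w /\<^sub>R fact w) = pmf W w" for w
    using pmf_W[of w] by (simp add: divide_inverse mult_ac)
  ultimately have "pmf W sums (pmf W 0 * exp (mean W))"
    by simp
  then have "pmf W 0 * exp (mean W) = 1"
    using pmf_sums_1 sums_unique2 by blast
  then have pmf_W_0: "pmf W 0 = exp (- mean W)"
    by (simp add: exp_minus field_simps)
  have "W = poisson_law (mean W)"
  proof (rule pmf_eqI)
    show "pmf W w = pmf (poisson_law (mean W)) w" for w
      using pmf_W[of w] mean_pos unfolding pmf_W_0 by (simp add: poisson_law_def mult_ac)
  qed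
  then show "is_poisson W"
    using mean_pos unfolding is_poisson_def by (intro exI[of _ "mean W"]) auto
qed

end

theorem theorem2p5:
  fixes W :: "nat pmf" and \<alpha> :: real
  assumes "integrable (measure_pmf W) real"
    and "measure_pmf.expectation W real > 0"
    and "map_pmf (\<lambda>w. w + 1) W \<ge>\<^sub>s\<^sub>t size_biased W"
    and "0 < \<alpha>" and "\<alpha> < 1"
  shows "let H = \<lambda>a. entropy_pmf (thinned_interp W a) in
      H differentiable (at \<alpha>)
      \<and> deriv H differentiable (at \<alpha>)
      \<and> deriv H \<alpha> \<le> 0
      \<and> deriv (deriv H) \<alpha> \<le> 0
      \<and> (deriv H \<alpha> = 0 \<longleftrightarrow> is_poisson W)
      \<and> (deriv (deriv H) \<alpha> = 0 \<longleftrightarrow> is_poisson W)"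
proof -
  interpret size_bias_dominated "mean W" "pmf W" "excess W"
    by (rule size_bias_dominated[OF assms(1-3)])
  define E where "E = (\<lambda>a. entropy_pmf (thinned_interp W a))"
  have E_eq: "E a = entropy_at a" if "a \<in> {0<..<1}" for a
    using that assms(2) by (simp add: E_def entropy_pmf_def entropy_at_def pmf_thinned_interp)
  have E_deriv: "(E has_field_derivative entropy_deriv a) (at a)" if "a \<in> {0<..<1}" for a
    by (rule has_field_derivative_transform_within_open[of entropy_at _ _ "{0<..<1}"])
      (use that entropy_at_deriv E_eq in auto)
  have deriv_E: "deriv E a = entropy_deriv a" if "a \<in> {0<..<1}" for a
    using E_deriv[OF that] by (rule DERIV_imp_deriv)
  have deriv_E_deriv: "(deriv E has_field_derivative entropy_deriv2 a) (at a)" if "a \<in> {0<..<1}" for a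
    by (rule has_field_derivative_transform_within_open[of entropy_deriv _ _ "{0<..<1}"])
      (use that entropy_deriv_deriv deriv_E in auto)
  have \<alpha>: "\<alpha> \<in> {0<..<1}"
    using assms(4,5) by simp
  have "deriv E \<alpha> = entropy_deriv \<alpha>" "deriv (deriv E) \<alpha> = entropy_deriv2 \<alpha>"
    using deriv_E[OF \<alpha>] DERIV_imp_deriv[OF deriv_E_deriv[OF \<alpha>]] by simp_all
  moreover have "E differentiable (at \<alpha>)" "deriv E differentiable (at \<alpha>)"
    using E_deriv[OF \<alpha>] deriv_E_deriv[OF \<alpha>] by (auto simp: real_differentiable_def)
  moreover have "entropy_deriv \<alpha> = 0 \<longleftrightarrow> is_poisson W" "entropy_deriv2 \<alpha> = 0 \<longleftrightarrow> is_poisson W"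
    using is_poisson_iff_drift_0[OF assms(1-3)] entropy_deriv_sign(2)[OF assms(4,5)] entropy_deriv2_sign(2)[OF assms(4,5)]
      entropy_derivs_zero[OF assms(4,5)] by blast+
  ultimately show ?thesis
    using entropy_deriv_sign(1)[OF assms(4,5)] entropy_deriv2_sign(1)[OF assms(4,5)]
    unfolding Let_def E_def[symmetric] by simp
qed

end
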